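(* For every $e\in[0,1)$, the elliptic Lagrangian orbit with eccentricity $e$ and mass parameter $\beta$ is strongly linearly stable, i.e. $\gamma_{\beta,e}(2\pi)$ is strongly linearly stable, if $\beta>0$ is small enough.
   Context: Let $J=\begin{pmatrix}0&-I_2\\ I_2&0\end{pmatrix}$ and $\mathrm{Sp}(4)=\{M\in \mathrm{GL}(4,\mathbb R): M^TJM=J\}$. For $(\beta,e)\in[0,9]\times[0,1)$ let $\gamma_{\beta,e}:[0,2\pi]\to\mathrm{Sp}(4)$ be the solution of $\dot\gamma(t)=JB(t)\gamma(t)$, $\gamma(0)=I_4$, where $$B(t)=\begin{pmatrix}1&0&0&1\\0&1&-1&0\\0&-1&\frac{2e\cos t-1-\sqrt{9-\beta}}{2(1+e\cos t)}&0\\1&0&0&\frac{2e\cos t-1+\sqrt{9-\beta}}{2(1+e\cos t)}\end{pmatrix}.$$ This is the essential part (Meyer–Schmidt) of the fundamental solution of the linearized Hamiltonian system along the elliptic Lagrangian solution of the planar three-body problem with eccentricity $e$ and mass parameter $\beta=27(m_1m_2+m_1m_3+m_2m_3)/(m_1+m_2+m_3)^2$; stability properties of the orbit mean those of the matrix $\gamma_{\beta,e}(2\pi)$. $M\in\mathrm{Sp}(4)$ is linearly stable if all its eigenvalues lie on the unit circle and $M$ is semi-simple; it is strongly linearly stable if there is $\epsilon>0$ such that every $N\in\mathrm{Sp}(4)$ with $\|M-N\|<\epsilon$ is linearly stable. *)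

theory Defs
  imports "HOL-Analysis.Analysis"
begin

lemma vector_4 [simp]:
  "(vector [a, b, c, d] :: 'a::zero ^ 4) $ 1 = a"
  "(vector [a, b, c, d] :: 'a::zero ^ 4) $ 2 = b"
  "(vector [a, b, c, d] :: 'a::zero ^ 4) $ 3 = c"
  "(vector [a, b, c, d] :: 'a::zero ^ 4) $ 4 = d"
  unfolding vector_def by simp_all

definition J4 :: "real^4^4" where
  "J4 = vector [vector [0, 0, -1,  0],
                vector [0, 0,  0, -1],
                vector [1, 0,  0,  0],
                vector [0, 1,  0,  0]]"

definition Sp4 :: "(real^4^4) set" where
  "Sp4 = {M. invertible M \<and> transpose M ** J4 ** M = J4}"

definition Bmat :: "real \<Rightarrow> real \<Rightarrow> real \<Rightarrow> real^4^4" where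
  "Bmat \<beta> e t = vector
    [vector [1,  0, 0, 1],
     vector [0,  1, -1, 0],
     vector [0, -1, (2 * e * cos t - 1 - sqrt (9 - \<beta>)) / (2 * (1 + e * cos t)), 0],
     vector [1,  0, 0, (2 * e * cos t - 1 + sqrt (9 - \<beta>)) / (2 * (1 + e * cos t))]]"

text \<open>The matrix path is only constrained on \<open>[0, 2 * pi]\<close>; the derivative at the two
  endpoints is one-sided.  On this interval the solution is unique, since the equation is linear
  with continuous coefficients.\<close>

definition is_fundamental_solution :: "real \<Rightarrow> real \<Rightarrow> (real \<Rightarrow> real^4^4) \<Rightarrow> bool" where
  "is_fundamental_solution \<beta> e \<gamma> \<longleftrightarrow>
     \<gamma> 0 = mat 1 \<and>
     (\<forall>t\<in>{0..2 * pi}.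
        (\<gamma> has_vector_derivative J4 ** Bmat \<beta> e t ** \<gamma> t) (at t within {0..2 * pi}))"

text \<open>Spectrum and semi-simplicity of a real matrix refer to its action on the complex
  4-space.\<close>

abbreviation cmat :: "real^'n^'m \<Rightarrow> complex^'n^'m" where
  "cmat M \<equiv> map_matrix complex_of_real M"

definition is_eigenvalue :: "complex^'n^'n \<Rightarrow> complex \<Rightarrow> bool" where
  "is_eigenvalue A \<mu> \<longleftrightarrow> (\<exists>v. v \<noteq> 0 \<and> A *v v = \<mu> *s v)"

definition semi_simple :: "complex^'n^'n \<Rightarrow> bool" where
  "semi_simple A \<longleftrightarrow>
     (\<exists>(P::complex^'n^'n) (D::complex^'n^'n). invertible P \<and>
        (\<forall>i j. i \<noteq> j \<longrightarrow> D $ i $ j = 0) \<and> A = P ** D ** matrix_inv P)"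

definition linearly_stable :: "real^4^4 \<Rightarrow> bool" where
  "linearly_stable M \<longleftrightarrow>
     M \<in> Sp4 \<and> (\<forall>\<mu>. is_eigenvalue (cmat M) \<mu> \<longrightarrow> cmod \<mu> = 1) \<and> semi_simple (cmat M)"

text \<open>The norm on \<^typ>\<open>real^4^4\<close> is the Frobenius norm; all norms on this space are
  equivalent, so the notion does not depend on the choice.\<close>

definition strongly_linearly_stable :: "real^4^4 \<Rightarrow> bool" where
  "strongly_linearly_stable M \<longleftrightarrow>
     M \<in> Sp4 \<and> (\<exists>\<epsilon>>0. \<forall>N\<in>Sp4. norm (M - N) < \<epsilon> \<longrightarrow> linearly_stable N)"

end

theory Submission
  imports Defs
begin

text \<open>For \<open>\<beta> = 0\<close> the system is the linearized Kepler problem and is solved explicitly: it has three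
  periodic solutions and a secular one, and in a symplectic frame \<open>Z\<close> of such solutions its monodromy
  is a shear. Put \<open>\<delta> = 3 - sqrt (9 - \<beta>)\<close>; the coefficient matrix is affine in \<open>\<delta>\<close>, so the monodromy is conjugate
  to the shear times \<open>1 + \<delta> J K + O(\<delta>\<^sup>2)\<close>, where \<open>K\<close> is the integral of the perturbing quadratic form
  along \<open>Z\<close>. This form is negative definite on the periodic solutions, which forces
  \<open>4 - trace M\<close> to be positive of order \<open>\<delta>\<close> and \<open>det (M - 1)\<close> to be positive of order \<open>\<delta>\<^sup>3\<close>. Since the eigenvalues
  \<open>\<lambda>\<close> of a symplectic \<open>M\<close> come from the roots \<open>x = \<lambda> + 1 / \<lambda>\<close> of
  \<open>(x - 2)\<^sup>2 + (4 - trace M) (x - 2) + det (M - 1)\<close>, they are four distinct points of the unit circle, and this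
  persists under small symplectic perturbations.\<close>

section \<open>Diagonalization by an annihilating polynomial with simple roots\<close>

text \<open>Induction on \<open>ls\<close>: \<open>A *v v - \<mu> *s v\<close> lies in the span of
  eigenvectors for the remaining values. On that span A - \<mu> is onto, because it multiplies each
  eigenvector by some nonzero \<nu> - \<mu>. So v differs from an element u of the span by a vector
  killed by A - \<mu>.\<close>

lemma fold_annihilator_in_span_eigenvectors:
  fixes A :: "'a::field^'n^'n"
  assumes "distinct ls" "fold (\<lambda>\<mu> w. A *v w - \<mu> *s w) ls v = 0"
  shows "v \<in> vec.span {w. \<exists>\<mu>\<in>set ls. A *v w = \<mu> *s w}"
  using assms
proof (induction ls arbitrary: v)
  case Nil
  then show ?case by (simp add: vec.span_zero)
next
  case (Cons \<mu> ls)
  let ?E = "\<lambda>ls. {w. \<exists>\<mu>\<in>set ls. A *v w = \<mu> *s w}"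
  have "A *v v - \<mu> *s v \<in> vec.span (?E ls)"
    using Cons by simp
  moreover have "\<exists>u\<in>vec.span (?E ls). A *v u - \<mu> *s u = w" if "w \<in> vec.span (?E ls)" for w
    using that
  proof (induction rule: vec.span_induct_alt)
    case base
    show ?case by (rule bexI[of _ 0]) (auto simp: vec.span_zero)
  next
    case (step c x y)
    then obtain \<nu> u where \<nu>: "\<nu> \<in> set ls" "A *v x = \<nu> *s x"
      and u: "u \<in> vec.span (?E ls)" "A *v u - \<mu> *s u = y" by blast
    have ne: "\<nu> - \<mu> \<noteq> 0" using \<nu> Cons.prems(1) by auto
    let ?u = "(c / (\<nu> - \<mu>)) *s x + u"
    have x: "x \<in> vec.span (?E ls)"
      using \<nu> by (intro vec.span_base) auto
    have "?u \<in> vec.span (?E ls)"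
      by (rule vec.span_add[OF vec.span_scale[OF x] u(1)])
    moreover have "A *v ?u - \<mu> *s ?u = (c / (\<nu> - \<mu>) * (\<nu> - \<mu>)) *s x + (A *v u - \<mu> *s u)"
      by (simp add: vec_eq_iff matrix_vector_right_distrib vec.scale \<nu>(2) algebra_simps diff_divide_distrib)
    ultimately show ?case using u ne by (intro bexI[of _ ?u]) auto
  qed
  ultimately obtain u where u: "u \<in> vec.span (?E ls)" "A *v u - \<mu> *s u = A *v v - \<mu> *s v"
    by blast
  have "A *v (v - u) = \<mu> *s (v - u)"
    using u(2) by (simp add: vec_eq_iff matrix_vector_mult_diff_distrib algebra_simps)
  then have "v - u \<in> vec.span (?E (\<mu> # ls))"
    by (intro vec.span_base) auto
  moreover have "u \<in> vec.span (?E (\<mu> # ls))"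
    using u(1) vec.span_mono[of "?E ls" "?E (\<mu> # ls)"] by auto
  ultimately show ?case
    using vec.span_add[of "v - u" _ u] by simp
qed

text \<open>A basis chosen among the eigenvectors supplies the columns of \<open>P\<close>.\<close>

lemma semi_simple_if_span_eigenvectors:
  fixes A :: "complex^'n^'n"
  assumes "vec.span {v. \<exists>\<mu>. A *v v = \<mu> *s v} = UNIV"
  shows "semi_simple A"
proof -
  let ?E = "{v. \<exists>\<mu>. A *v v = \<mu> *s v}"
  obtain B where B: "B \<subseteq> ?E" "vec.independent B" "?E \<subseteq> vec.span B" "card B = vec.dim ?E"
    using vec.basis_exists[of ?E] by blast
  have spB: "vec.span B = UNIV"
    using vec.span_minimal[OF B(3) vec.subspace_span] assms by blast
  have "card B = CARD('n)"
    using B(4) vec.dim_span[of ?E] unfolding assms vec_dim_card by simp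
  moreover have "finite B" using B(2) by (rule vec.finiteI_independent)
  ultimately obtain h where h: "bij_betw h (UNIV::'n set) B"
    by (metis finite_class.finite_UNIV finite_same_card_bij)
  have "\<forall>i. \<exists>\<mu>. A *v h i = \<mu> *s h i"
    using h B(1) by (auto simp: bij_betw_def)
  then obtain m where m: "\<And>i. A *v h i = m i *s h i" by metis
  define P :: "complex^'n^'n" where "P = (\<chi> i j. h j $ i)"
  define D :: "complex^'n^'n" where "D = (\<chi> i j. if i = j then m i else 0)"
  have colP: "column j P = h j" for j by (simp add: P_def column_def vec_eq_iff)
  have "columns P = B"
    using h by (auto simp: columns_def colP bij_betw_def)
  then have inv: "invertible P"
    using spB matrix_right_invertible_span_columns[of P] unfolding invertible_right_inverse by simp
  have "A ** P = P ** D"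
  proof -
    have "(A ** P) $ i $ j = (P ** D) $ i $ j" for i j
    proof -
      have "(A ** P) $ i $ j = (A *v h j) $ i"
        by (simp add: matrix_matrix_mult_def matrix_vector_mult_def P_def)
      also have "\<dots> = m j * h j $ i" by (simp add: m)
      also have "\<dots> = (P ** D) $ i $ j"
        by (simp add: matrix_matrix_mult_def P_def D_def if_distrib cong: if_cong)
      finally show ?thesis .
    qed
    then show ?thesis by (simp add: vec_eq_iff)
  qed
  moreover have "P ** matrix_inv P = mat 1"
    using inv unfolding invertible_def matrix_inv_def by (rule someI_ex[THEN conjunct1])
  ultimately have "A = P ** D ** matrix_inv P"
    by (metis matrix_mul_assoc matrix_mul_rid)
  then show ?thesis
    unfolding semi_simple_def
    by (intro exI[of _ P] exI[of _ D]) (simp add: inv, simp add: D_def)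
qed

lemma fold_eigenvector:
  fixes A :: "'a::field^'n^'n"
  assumes "A *v v = \<mu> *s v"
  shows "fold (\<lambda>\<nu> w. A *v w - \<nu> *s w) ls (k *s v) = (k * (\<Prod>\<nu>\<leftarrow>ls. \<mu> - \<nu>)) *s v"
proof (induction ls arbitrary: k)
  case (Cons \<nu> ls)
  have "A *v (k *s v) - \<nu> *s (k *s v) = (k * (\<mu> - \<nu>)) *s v"
    by (simp add: vec_eq_iff vec.scale assms algebra_simps)
  then show ?case using Cons[of "k * (\<mu> - \<nu>)"] by (simp add: mult.assoc)
qed simp

lemma eigenvalue_root_of_annihilator:
  fixes A :: "complex^'n^'n"
  assumes "\<And>v. fold (\<lambda>\<mu> w. A *v w - \<mu> *s w) ls v = 0" "is_eigenvalue A \<mu>"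
  shows "\<mu> \<in> set ls"
proof -
  obtain v where v: "v \<noteq> 0" "A *v v = \<mu> *s v" using assms(2) by (auto simp: is_eigenvalue_def)
  have "(\<Prod>\<nu>\<leftarrow>ls. \<mu> - \<nu>) *s v = 0"
    using fold_eigenvector[OF v(2), of ls 1] assms(1)[of v] by simp
  then show ?thesis using v(1) by (auto simp: prod_list_zero_iff)
qed

section \<open>Symplectic matrices\<close>

text \<open>The inverse of a symplectic matrix, in a form linear in \<open>N\<close>, so that traces
  and derivatives of inverses are computed directly.\<close>

definition symplectic_inv :: "real^4^4 \<Rightarrow> real^4^4" where
  "symplectic_inv N = - (J4 ** transpose N ** J4)"

definition pfaffian4 :: "real^4^4 \<Rightarrow> real" where
  "pfaffian4 A = A$1$2 * A$3$4 - A$1$3 * A$2$4 + A$1$4 * A$2$3"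

lemma J4_square: "J4 ** J4 = - mat 1"
  by (simp add: vec_eq_iff forall_4 matrix_matrix_mult_def sum_4 J4_def mat_def)

lemma transpose_J4: "transpose J4 = - J4"
  by (simp add: vec_eq_iff forall_4 transpose_def J4_def)

lemma matrix_neg_left: "(- A) ** B = - (A ** (B :: 'a::ring_1^'n^'m))"
  by (simp add: vec_eq_iff matrix_matrix_mult_def sum_negf)

lemma matrix_neg_right: "A ** (- B) = - (A ** (B :: 'a::ring_1^'n^'m))"
  by (simp add: vec_eq_iff matrix_matrix_mult_def sum_negf)

lemma matrix_add_rdistrib: "(A + B) ** C = A ** C + B ** (C :: 'a::semiring_1^'n^'m)"
  by (simp add: vec_eq_iff matrix_matrix_mult_def sum.distrib distrib_right)

lemma symplectic_inv_left:
  assumes "transpose N ** J4 ** N = J4"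
  shows "symplectic_inv N ** N = mat 1"
proof -
  have "symplectic_inv N ** N = - (J4 ** (transpose N ** J4 ** N))"
    by (simp add: symplectic_inv_def matrix_neg_left matrix_mul_assoc)
  then show ?thesis by (simp add: assms J4_square)
qed

lemma symplectic_inv_right:
  assumes "transpose N ** J4 ** N = J4"
  shows "N ** symplectic_inv N = mat 1"
  using symplectic_inv_left[OF assms] by (simp add: matrix_left_right_inverse)

lemma Sp4_iff: "N \<in> Sp4 \<longleftrightarrow> transpose N ** J4 ** N = J4"
  using symplectic_inv_left invertible_left_inverse by (auto simp: Sp4_def)

text \<open>Cayley--Hamilton for the Pfaffian of the pencil \<open>A - x J\<close>, which is only quadratic in \<open>x\<close>.\<close>

lemma skew_quadratic:
  fixes A :: "real^4^4"
  assumes "transpose A = - A"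
  shows "(J4 ** A) ** (J4 ** A)
     = pfaffian4 A *\<^sub>R mat 1 + (A$1$3 + A$2$4) *\<^sub>R (J4 ** A)"
proof -
  have *: "A $ i $ j = - A $ j $ i" for i j
    using arg_cong[OF assms, of "\<lambda>X. X $ j $ i"] by (simp add: transpose_def)
  have d: "A$1$1 = 0" "A$2$2 = 0" "A$3$3 = 0" "A$4$4 = 0"
    using *[of 1 1] *[of 2 2] *[of 3 3] *[of 4 4] by auto
  show ?thesis
    by (simp add: vec_eq_iff forall_4 matrix_matrix_mult_def sum_4 J4_def mat_def pfaffian4_def d
      *[of 2 1] *[of 3 1] *[of 4 1] *[of 3 2] *[of 4 2] *[of 4 3] algebra_simps)
qed

lemma symplectic_trace_inv: "trace (symplectic_inv N) = trace N"
  by (simp add: symplectic_inv_def trace_def matrix_matrix_mult_def sum_4 J4_def transpose_def)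

text \<open>\<open>J4 ** S\<close> is skew, so \<open>skew_quadratic\<close> gives \<open>S\<close>
  an annihilating polynomial x^2 - (trace N) x + q of degree two only. The second claim is its value
  at x = 2, the Pfaffian expression for det (N - 1).\<close>

lemma symplectic_quadratic:
  fixes N :: "real^4^4"
  assumes N: "transpose N ** J4 ** N = J4"
  defines "S \<equiv> N + symplectic_inv N"
    and "W \<equiv> transpose (N - mat 1) ** J4 ** (N - mat 1)"
    and "q \<equiv> ((trace N)\<^sup>2 - trace (N ** N)) / 2 - 2"
  shows "S ** S = trace N *\<^sub>R S - q *\<^sub>R mat 1" and "q - 2 * trace N + 4 = - pfaffian4 W"
proof -
  define A where "A = J4 ** S"
  have JA: "J4 ** A = - S"
    by (simp add: A_def matrix_mul_assoc J4_square matrix_neg_left)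
  have A: "A = J4 ** N + transpose N ** J4"
    by (simp add: A_def S_def symplectic_inv_def matrix_add_ldistrib matrix_neg_right matrix_mul_assoc
       J4_square matrix_neg_left del: add_uminus_conv_diff)
  have sk: "transpose A = - A"
    by (simp add: A vec_eq_iff transpose_def forall_4 matrix_matrix_mult_def sum_4 J4_def)
  have tr: "A$1$3 + A$2$4 = - trace N"
    by (simp add: A trace_def matrix_matrix_mult_def sum_4 J4_def transpose_def)
  have SS: "S ** S = trace N *\<^sub>R S + pfaffian4 A *\<^sub>R mat 1"
    using skew_quadratic[OF sk] by (simp add: JA tr matrix_neg_left matrix_neg_right)
  have trS: "trace S = 2 * trace N"
    by (simp add: S_def trace_add symplectic_trace_inv)
  have inv: "symplectic_inv N ** N = mat 1" "N ** symplectic_inv N = mat 1"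
    using symplectic_inv_left[OF N] symplectic_inv_right[OF N] .
  have sandwich: "J4 ** X ** J4 ** (J4 ** Y ** J4) = - (J4 ** X ** Y ** J4)" for X Y :: "real^4^4"
  proof -
    have "J4 ** X ** J4 ** (J4 ** Y ** J4) = J4 ** X ** (J4 ** J4) ** Y ** J4"
      by (simp only: matrix_mul_assoc)
    then show ?thesis by (simp add: J4_square matrix_neg_left matrix_neg_right)
  qed
  have tr_scale: "trace (k *\<^sub>R X) = k * trace X" for k and X :: "real^4^4"
    by (simp add: trace_def sum_distrib_left)
  have "symplectic_inv N ** symplectic_inv N = symplectic_inv (N ** N)"
    using sandwich[of "transpose N" "transpose N"]
    by (simp add: symplectic_inv_def matrix_neg_left matrix_neg_right matrix_transpose_mul matrix_mul_assoc)
  then have "S ** S = N ** N + symplectic_inv (N ** N) + 2 *\<^sub>R mat 1"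
    by (simp add: S_def matrix_add_ldistrib matrix_add_rdistrib inv scaleR_2)
  \<comment> \<open>The trace of \<open>S ** S\<close>, computed from the definition of
    \<open>S\<close> and again from the quadratic relation, determines the Pfaffian of
    \<open>A\<close>.\<close>
  then have "2 * trace (N ** N) + 8 = trace (S ** S)"
    by (simp add: trace_add tr_scale symplectic_trace_inv trace_I)
  also have "\<dots> = 2 * (trace N)\<^sup>2 + 4 * pfaffian4 A"
    by (simp add: SS trace_add tr_scale trS trace_I power2_eq_square)
  finally have q: "q = - pfaffian4 A" by (simp add: q_def field_simps)
  show "S ** S = trace N *\<^sub>R S - q *\<^sub>R mat 1" by (simp add: SS q)
  have "W = transpose N ** J4 ** N + J4 - A"
    unfolding A W_def
    by (simp add: vec_eq_iff transpose_def forall_4 matrix_matrix_mult_def sum_4 J4_def mat_def algebra_simps)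
  then have W: "W = 2 *\<^sub>R J4 - A" using N by (simp add: scaleR_2)
  show "q - 2 * trace N + 4 = - pfaffian4 W"
    using tr by (simp add: W q pfaffian4_def J4_def algebra_simps)
qed

text \<open>Here \<open>c\<close> and \<open>d\<close> are, for symplectic \<open>N\<close>, the coefficients of the quadratic
  \<open>y\<^sup>2 + c y + d\<close> for \<open>y = \<lambda> + 1 / \<lambda> - 2\<close>, and \<open>d = det (N - 1)\<close>; traces make conjugation invariance immediate.
  The inequalities place both roots strictly between \<open>-4\<close> and \<open>0\<close> and keep them apart.\<close>

definition elliptic_region :: "(real^4^4) set" where
  "elliptic_region = {N. let c = 4 - trace N; d = ((trace N)\<^sup>2 - trace (N ** N)) / 2 + 2 - 2 * trace N
     in 0 < c \<and> c < 4 \<and> 0 < d \<and> 4 * d < c\<^sup>2}"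

lemma open_elliptic_region: "open elliptic_region"
proof -
  have "continuous_on UNIV (\<lambda>N::real^4^4. N $ i $ j)" for i j
    by (intro continuous_intros)
  then have [continuous_intros]: "continuous_on UNIV (\<lambda>N::real^4^4. trace N)"
      "continuous_on UNIV (\<lambda>N::real^4^4. trace (N ** N))"
    by (auto simp: trace_def matrix_matrix_mult_def intro!: continuous_intros)
  show ?thesis
    unfolding elliptic_region_def Let_def
    by (intro open_Collect_conj open_Collect_less continuous_intros) auto
qed

lemma elliptic_region_similar:
  assumes "N \<in> elliptic_region" and inv: "P ** Q = mat 1" and M: "M ** P = P ** N"
  shows "M \<in> elliptic_region"
proof -
  have QP: "Q ** P = mat 1" using inv by (simp add: matrix_left_right_inverse)
  have MN: "M = P ** N ** Q"
    using M inv by (metis matrix_mul_assoc matrix_mul_rid)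
  have tr: "trace (P ** X ** Q) = trace X" for X
    using trace_mul_sym[of "P ** X" Q] by (simp add: matrix_mul_assoc QP)
  have "M ** M = P ** N ** (Q ** P) ** N ** Q"
    unfolding MN by (simp only: matrix_mul_assoc)
  then have "M ** M = P ** (N ** N) ** Q"
    by (simp add: QP matrix_mul_assoc)
  then show ?thesis
    using assms(1) tr[of N] tr[of "N ** N"] by (simp add: elliptic_region_def MN)
qed

lemma cmat_mult: "cmat (A ** B) = cmat A ** cmat B"
  by (simp add: vec_eq_iff map_matrix_def matrix_matrix_mult_def)

lemma cmat_add: "cmat (A + B) = cmat A + cmat B"
  by (simp add: vec_eq_iff map_matrix_def)

lemma cmat_scale_mult: "cmat (k *\<^sub>R A) *v v = complex_of_real k *s (cmat A *v v)"
  by (simp add: vec_eq_iff map_matrix_def matrix_vector_mult_def sum_distrib_left mult.assoc)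

lemma cmat_id: "cmat (mat 1) = mat 1"
  by (simp add: vec_eq_iff map_matrix_def mat_def)

text \<open>The numbers x - 2 and y - 2 are the roots of Y^2 + c Y + d. With \<open>s\<close> the
  square root of the discriminant, 0 < s < c puts both (- c + s) / 2 and (- c - s) / 2 between - c
  and 0, hence between -4 and 0.\<close>

lemma elliptic_roots:
  fixes c d :: real
  assumes "0 < c" "c < 4" "0 < d" "4 * d < c\<^sup>2"
  obtains x y where "x \<noteq> y" "- 2 < x" "x < 2" "- 2 < y" "y < 2"
    "x + y = 4 - c" "x * y = d + 4 - 2 * c"
proof -
  obtain s where s: "0 < s" "s < c" "s\<^sup>2 = c\<^sup>2 - 4 * d"
    using assms by (intro that[of "sqrt (c\<^sup>2 - 4 * d)"]) (auto intro: real_less_lsqrt)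
  have "(2 + (- c + s) / 2) * (2 + (- c - s) / 2) = d + 4 - 2 * c"
    using s(3) by (simp add: field_simps power2_eq_square)
  then show thesis
    using s(1,2) assms by (intro that[of "2 + (- c + s) / 2" "2 + (- c - s) / 2"]) (simp_all add: field_simps)
qed

text \<open>If l + 1 / l = z, then (N - l) (N - 1 / l) = N (S - z), because N S = N^2 + 1.
  Multiplying the factors for the two roots x, y gives N^2 (S - x) (S - y) = 0, so N has an
  annihilating polynomial with four distinct roots on the unit circle.\<close>

lemma linearly_stable_if_elliptic:
  assumes N: "N \<in> Sp4" and el: "N \<in> elliptic_region"
  shows "linearly_stable N"
proof -
  define q where "q = ((trace N)\<^sup>2 - trace (N ** N)) / 2 - 2"
  define S where "S = N + symplectic_inv N"
  have NJ: "transpose N ** J4 ** N = J4" using N by (simp add: Sp4_iff)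
  obtain x y :: real where xy: "x \<noteq> y" "- 2 < x" "x < 2" "- 2 < y" "y < 2"
    "x + y = trace N" "x * y = q"
    using el elliptic_roots[of "4 - trace N" "((trace N)\<^sup>2 - trace (N ** N)) / 2 + 2 - 2 * trace N"]
    by (auto simp: elliptic_region_def Let_def q_def)
  \<comment> \<open>The solution of l + 1 / l = z in the upper half plane; for -2 < z < 2 it has
    modulus one and is not real.\<close>
  define r where "r z = Complex (z / 2) (sqrt (4 - z\<^sup>2) / 2)" for z :: real
  have r: "r z + cnj (r z) = of_real z" "r z * cnj (r z) = 1" "cmod (r z) = 1" "r z \<noteq> cnj (r z)"
    if "- 2 < z" "z < 2" for z
  proof -
    have z: "z\<^sup>2 < 4"
      using mult_pos_pos[of "2 - z" "2 + z"] that by (simp add: algebra_simps power2_eq_square)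
    have n: "(cmod (r z))\<^sup>2 = 1"
      using z by (simp add: r_def cmod_power2 power_divide field_simps)
    then show 1: "cmod (r z) = 1" using norm_ge_zero[of "r z"] by (simp add: power2_eq_1_iff) 
    show "r z * cnj (r z) = 1" using n complex_norm_square[of "r z"] by simp
    show "r z + cnj (r z) = of_real z" by (simp add: r_def complex_eq_iff)
    show "r z \<noteq> cnj (r z)" using z by (simp add: r_def complex_eq_iff)
  qed
  let ?ls = "[r x, cnj (r x), r y, cnj (r y)]"
  have dist: "distinct ?ls"
    using r(4)[OF xy(2,3)] r(4)[OF xy(4,5)] xy(1) by (auto simp: r_def complex_eq_iff)
  let ?C = "cmat N" and ?S = "cmat S"
  have CS: "?S *v (?C *v w) = ?C *v (?S *v w)" for w
    using symplectic_inv_left[OF NJ] symplectic_inv_right[OF NJ]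
    by (simp add: matrix_vector_mul_assoc S_def matrix_add_ldistrib matrix_add_rdistrib flip: cmat_mult)
  have NS: "?C *v (?S *v w) = ?C *v (?C *v w) + w" for w
  proof -
    have "N ** S = N ** N + mat 1"
      by (simp add: S_def matrix_add_ldistrib symplectic_inv_right[OF NJ])
    then have "cmat (N ** S) *v w = cmat (N ** N + mat 1) *v w" by simp
    then show ?thesis
      by (simp add: cmat_add cmat_id cmat_mult matrix_vector_mult_add_rdistrib
          flip: matrix_vector_mul_assoc)
  qed
  have "S ** S + q *\<^sub>R mat 1 = trace N *\<^sub>R S"
    using symplectic_quadratic(1)[OF NJ] by (simp add: S_def q_def)
  then have "cmat (S ** S + q *\<^sub>R mat 1) *v w = cmat (trace N *\<^sub>R S) *v w" for w by simp
  then have SS: "?S *v (?S *v w) + of_real q *s w = of_real (trace N) *s (?S *v w)" for w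
    by (simp add: cmat_add cmat_scale_mult cmat_id matrix_vector_mult_add_rdistrib cmat_mult
        flip: matrix_vector_mul_assoc)
  have pair: "?C *v (?C *v w - l *s w) - cnj l *s (?C *v w - l *s w) = ?C *v (?S *v w - of_real z *s w)"
    if "l + cnj l = of_real z" "l * cnj l = 1" for w l z
  proof -
    have "?C *v (?C *v w - l *s w) - cnj l *s (?C *v w - l *s w)
        = ?C *v (?C *v w) - (l + cnj l) *s (?C *v w) + (l * cnj l) *s w"
      by (simp add: vec_eq_iff matrix_vector_mult_diff_distrib vec.scale algebra_simps)
    also have "\<dots> = ?C *v (?S *v w - of_real z *s w)"
      by (simp add: that matrix_vector_mult_diff_distrib NS vec.scale)
    finally show ?thesis .
  qed
  have ann: "fold (\<lambda>\<mu> w. ?C *v w - \<mu> *s w) ?ls v = 0" for v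
  proof -
    let ?u = "?S *v v - of_real x *s v"
    have "?S *v ?u - of_real y *s ?u
        = (?S *v (?S *v v) + of_real q *s v) - of_real (trace N) *s (?S *v v)"
      by (simp add: vec_eq_iff matrix_vector_mult_diff_distrib vec.scale algebra_simps flip: xy(6,7))
    then have "?S *v ?u - of_real y *s ?u = 0" by (simp add: SS)
    then have "?C *v (?S *v (?C *v ?u) - of_real y *s (?C *v ?u)) = 0"
      by (metis CS matrix_vector_mult_0_right matrix_vector_mult_diff_distrib vec.scale)
    then show ?thesis
      by (simp only: fold_simps pair[OF r(1,2)[OF xy(2,3)]] pair[OF r(1,2)[OF xy(4,5)]])
  qed
  have "vec.span {v. \<exists>\<mu>. ?C *v v = \<mu> *s v} = UNIV"
  proof -
    have "v \<in> vec.span {v. \<exists>\<mu>. ?C *v v = \<mu> *s v}" for v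
      using fold_annihilator_in_span_eigenvectors[OF dist ann, of v]
        vec.span_mono[of "{w. \<exists>\<mu>\<in>set ?ls. ?C *v w = \<mu> *s w}" "{v. \<exists>\<mu>. ?C *v v = \<mu> *s v}"]
      by blast
    then show ?thesis by blast
  qed
  moreover have "cmod \<mu> = 1" if "is_eigenvalue ?C \<mu>" for \<mu>
    using eigenvalue_root_of_annihilator[OF ann that] r(3)[OF xy(2,3)] r(3)[OF xy(4,5)] by auto
  ultimately show ?thesis
    using N semi_simple_if_span_eigenvectors by (auto simp: linearly_stable_def)
qed

lemma strongly_linearly_stable_if_elliptic:
  assumes "M \<in> Sp4" "M \<in> elliptic_region"
  shows "strongly_linearly_stable M"
proof -
  obtain \<epsilon> where "\<epsilon> > 0" "ball M \<epsilon> \<subseteq> elliptic_region"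
    using open_elliptic_region assms(2) open_contains_ball by blast
  then show ?thesis
    unfolding strongly_linearly_stable_def using assms(1) linearly_stable_if_elliptic
    by (intro conjI exI[of _ \<epsilon>]) (auto simp: dist_norm)
qed

section \<open>Linear differential equations with a small coefficient\<close>

lemma bounded_bilinear_matrix_mult:
  "bounded_bilinear ((**) :: real^'n^'m \<Rightarrow> real^'k^'n \<Rightarrow> real^'k^'m)"
  unfolding bilinear_conv_bounded_bilinear[symmetric] bilinear_def
  by (auto intro!: linearI simp: vec_eq_iff matrix_matrix_mult_def sum.distrib sum_distrib_left algebra_simps)

lemmas has_vector_derivative_matrix_mult = bounded_bilinear.has_vector_derivative[OF bounded_bilinear_matrix_mult]

lemma norm_diff_le_of_has_vector_derivative:
  fixes f :: "real \<Rightarrow> 'a::real_normed_vector"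
  assumes "\<And>t. t \<in> {a..b} \<Longrightarrow> (f has_vector_derivative f' t) (at t within {a..b})"
    and B: "\<And>t. t \<in> {a..b} \<Longrightarrow> norm (f' t) \<le> B" and t: "t \<in> {a..b}"
  shows "norm (f t - f a) \<le> B * (t - a)"
proof -
  have "norm (f t - f a) \<le> B * norm (t - a)"
  proof (rule differentiable_bound[of "{a..b}" f "\<lambda>t h. h *\<^sub>R f' t"])
    show "onorm (\<lambda>h. h *\<^sub>R f' t) \<le> B" if "t \<in> {a..b}" for t
      using B[OF that] by (intro onorm_le) (simp add: mult.commute[of B] mult_left_mono)
  qed (use assms t in \<open>auto simp: has_vector_derivative_def\<close>)
  then show ?thesis using t by simp
qed

text \<open>A priori bound, then two integrations: at the maximum of \<open>norm (Y t)\<close> the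
  smallness of \<delta> bounds Y uniformly, hence Y - 1 = O(\<delta>), and inserting this into the
  equation leaves an error O(\<delta>^2). \<open>C\<close> is chosen before \<delta> and Y.\<close>

lemma linear_ode_first_order:
  fixes F :: "real \<Rightarrow> real^'n^'n"
  assumes T: "0 \<le> T" and F: "continuous_on {0..T} F"
  obtains C where "0 < C"
    "\<And>\<delta> Y. \<lbrakk>0 \<le> \<delta>; C * \<delta> \<le> 1; Y 0 = mat 1;
       \<forall>t\<in>{0..T}. (Y has_vector_derivative \<delta> *\<^sub>R (F t ** Y t)) (at t within {0..T})\<rbrakk>
     \<Longrightarrow> norm (Y T - mat 1 - \<delta> *\<^sub>R integral {0..T} F) \<le> C * \<delta>\<^sup>2"
proof -
  have "\<exists>K>0. \<forall>(A :: real^'n^'n) (B :: real^'n^'n). norm (A ** B) \<le> norm A * norm B * K"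
    by (rule bounded_bilinear.pos_bounded[OF bounded_bilinear_matrix_mult])
  then obtain c where c: "c > 0" "\<And>(A :: real^'n^'n) (B :: real^'n^'n). norm (A ** B) \<le> norm A * norm B * c"
    by auto
  obtain \<kappa> where \<kappa>: "\<kappa> > 0" "\<And>t. t \<in> {0..T} \<Longrightarrow> norm (F t) \<le> \<kappa>"
    using compact_imp_bounded[OF compact_continuous_image[OF F compact_Icc]]
    unfolding bounded_pos by blast
  define k where "k = \<kappa> * c"
  define i where "i = norm (mat 1 :: real^'n^'n)"
  have k: "k > 0" using c(1) \<kappa>(1) by (simp add: k_def)
  have i: "i \<ge> 0" by (simp add: i_def)
  have FX: "norm (F t ** X) \<le> k * norm X" if "t \<in> {0..T}" for t and X :: "real^'n^'n"
  proof -
    have "norm (F t ** X) \<le> norm (F t) * norm X * c" using c(2)[of "F t" X] by simp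
    also have "\<dots> \<le> \<kappa> * norm X * c" using \<kappa>(2)[OF that] c(1) by (intro mult_right_mono) auto
    finally show ?thesis by (simp add: k_def mult_ac)
  qed
  \<comment> \<open>The first term yields \<delta> k T \<le> 1 / 2, the second is the final error
    constant, and 1 ensures positivity.\<close>
  define C where "C = 2 * k * T + 2 * k\<^sup>2 * T\<^sup>2 * i + 1"
  have nn: "0 \<le> k * T" "0 \<le> k\<^sup>2 * T\<^sup>2 * i" using k i T by simp_all
  have C: "C > 0" "2 * k * T \<le> C" "2 * k\<^sup>2 * T\<^sup>2 * i \<le> C" using nn by (simp_all add: C_def)
  show thesis
  proof (rule that[OF C(1)])
    fix \<delta> :: real and Y :: "real \<Rightarrow> real^'n^'n"
    assume \<delta>: "0 \<le> \<delta>" "C * \<delta> \<le> 1" and Y0: "Y 0 = mat 1"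
      and ode: "\<forall>t\<in>{0..T}. (Y has_vector_derivative \<delta> *\<^sub>R (F t ** Y t)) (at t within {0..T})"
    have Y: "(Y has_vector_derivative \<delta> *\<^sub>R (F t ** Y t)) (at t within {0..T})" if "t \<in> {0..T}" for t
      using ode that by blast
    have "continuous_on {0..T} Y"
      using Y by (rule continuous_on_vector_derivative)
    then have "continuous_on {0..T} (\<lambda>t. norm (Y t))" by (intro continuous_intros)
    then obtain s where s: "s \<in> {0..T}" "\<And>t. t \<in> {0..T} \<Longrightarrow> norm (Y t) \<le> norm (Y s)"
      using continuous_attains_sup[of "{0..T}" "\<lambda>t. norm (Y t)"] T by auto
    have dev: "norm (Y t - mat 1) \<le> \<delta> * k * norm (Y s) * T" if t: "t \<in> {0..T}" for t
    proof -
      have "norm (Y t - Y 0) \<le> \<delta> * k * norm (Y s) * (t - 0)"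
      proof (rule norm_diff_le_of_has_vector_derivative[OF Y _ t])
        fix u assume u: "u \<in> {0..T}"
        have "norm (F u ** Y u) \<le> k * norm (Y s)"
          using order_trans[OF FX[OF u, of "Y u"] mult_left_mono[OF s(2)[OF u]]] k by simp
        then show "norm (\<delta> *\<^sub>R (F u ** Y u)) \<le> \<delta> * k * norm (Y s)"
          using \<delta>(1) by (simp add: mult_left_mono mult.assoc)
      qed
      also have "\<dots> \<le> \<delta> * k * norm (Y s) * T"
        using t k \<delta>(1) by (intro mult_left_mono) auto
      finally show ?thesis by (simp add: Y0)
    qed
    have "norm (Y s) \<le> i + norm (Y s - mat 1)"
      using norm_triangle_ineq[of "mat 1" "Y s - mat 1"] by (simp add: i_def)
    also have "\<dots> \<le> i + (\<delta> * k * T) * norm (Y s)"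
      using dev[OF s(1)] by (simp add: mult_ac)
    also have "\<dots> \<le> i + 1/2 * norm (Y s)"
    proof -
      have "2 * k * T * \<delta> \<le> C * \<delta>" using C(2) \<delta>(1) by (rule mult_right_mono)
      then have "\<delta> * k * T \<le> 1 / 2" using \<delta>(2) by (simp add: mult_ac)
      then show ?thesis by (intro add_left_mono mult_right_mono) auto
    qed
    finally have m: "norm (Y s) \<le> 2 * i" by simp
    have dev2: "norm (Y t - mat 1) \<le> \<delta> * k * (2 * i) * T" if t: "t \<in> {0..T}" for t
    proof -
      have "\<delta> * k * T * norm (Y s) \<le> \<delta> * k * T * (2 * i)"
        using m k \<delta>(1) T by (intro mult_left_mono) simp_all
      then show ?thesis using dev[OF t] by (simp add: mult_ac)
    qed
    \<comment> \<open>Removing the first-order term leaves the derivative \<delta> F (Y - 1),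
      already of second order.\<close>
    define H where "H t = Y t - \<delta> *\<^sub>R integral {0..t} F" for t
    have "norm (H T - H 0) \<le> \<delta> * (k * (\<delta> * k * (2 * i) * T)) * (T - 0)"
    proof (rule norm_diff_le_of_has_vector_derivative)
      fix t assume t: "t \<in> {0..T}"
      show "(H has_vector_derivative \<delta> *\<^sub>R (F t ** Y t) - \<delta> *\<^sub>R F t) (at t within {0..T})"
        unfolding H_def
        by (rule has_vector_derivative_diff[OF Y[OF t]
            bounded_linear.has_vector_derivative[OF bounded_linear_scaleR_right integral_has_vector_derivative[OF F t]]])
      have "F t ** (Y t - mat 1) = F t ** Y t - F t"
        using bounded_bilinear.diff_right[OF bounded_bilinear_matrix_mult, of "F t" "Y t" "mat 1"] by simp
      then have "norm (\<delta> *\<^sub>R (F t ** Y t) - \<delta> *\<^sub>R F t) = \<delta> * norm (F t ** (Y t - mat 1))"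
        using \<delta>(1) by (simp flip: scaleR_right_diff_distrib)
      also have "\<dots> \<le> \<delta> * (k * norm (Y t - mat 1))"
        using FX[OF t] \<delta>(1) by (intro mult_left_mono)
      also have "\<dots> \<le> \<delta> * (k * (\<delta> * k * (2 * i) * T))"
        using dev2[OF t] \<delta>(1) k by (intro mult_left_mono) auto
      finally show "norm (\<delta> *\<^sub>R (F t ** Y t) - \<delta> *\<^sub>R F t) \<le> \<delta> * (k * (\<delta> * k * (2 * i) * T))" .
    qed (use T in auto)
    also have "\<dots> = (2 * k\<^sup>2 * T\<^sup>2 * i) * \<delta>\<^sup>2" by (simp add: power2_eq_square mult_ac)
    also have "\<dots> \<le> C * \<delta>\<^sup>2" using C(3) by (intro mult_right_mono) auto
    finally show "norm (Y T - mat 1 - \<delta> *\<^sub>R integral {0..T} F) \<le> C * \<delta>\<^sup>2"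
      by (simp add: H_def Y0 algebra_simps)
  qed
qed

section \<open>The linearized Kepler problem\<close>

lemma has_vector_derivative_vecI:
  fixes f :: "real \<Rightarrow> 'a::real_normed_vector^'n"
  assumes "\<And>i. ((\<lambda>t. f t $ i) has_vector_derivative f' $ i) F"
  shows "(f has_vector_derivative f') F"
proof -
  have expand: "x = (\<Sum>i\<in>UNIV. axis i (x $ i))" for x :: "'a^'n"
    by (simp add: vec_eq_iff axis_def if_distrib[of "\<lambda>v. v $ _"] cong: if_cong)
  have lin: "bounded_linear (axis i :: 'a \<Rightarrow> 'a^'n)" for i
  proof (rule bounded_linear_intro[where K = 1])
    show "axis i (x + y) = axis i x + axis i y" for x y :: 'a by (simp add: vec_eq_iff axis_def)
    show "axis i (k *\<^sub>R x) = k *\<^sub>R axis i x" for k and x :: 'a by (simp add: vec_eq_iff axis_def)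
    show "norm (axis i x) \<le> norm x * 1" for x :: 'a 
      by (simp add: norm_vec_def L2_set_def axis_def if_distrib[of norm] if_distrib[of "\<lambda>x. x\<^sup>2"] cong: if_cong)
  qed
  have "((\<lambda>t. \<Sum>i\<in>UNIV. axis i (f t $ i)) has_vector_derivative (\<Sum>i\<in>UNIV. axis i (f' $ i))) F"
    by (intro has_vector_derivative_sum bounded_linear.has_vector_derivative[OF lin] assms)
  then show ?thesis by (simp flip: expand)
qed

text \<open>The last two rows are the positions \<open>(q\<^sub>1, q\<^sub>2)\<close>, the first two the momenta \<open>(q\<^sub>1' - q\<^sub>2, q\<^sub>2' + q\<^sub>1)\<close>.
  In position space the columns are built from the time shift \<open>v = (e r s, r\<^sup>2)\<close>, the rotation \<open>(0, 1)\<close>,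
  the periodic solutions \<open>f\<^sub>2 = (r s, 2 c + e c\<^sup>2)\<close> and \<open>f\<^sub>3 = (r c, - 2 s - e s c)\<close>, where \<open>v = (0, 1) + e f\<^sub>2\<close>,
  and the scaling solution \<open>f\<^sub>4 = (2, 0) - 3 T v\<close>, where \<open>T' = 1 / r\<^sup>2\<close>; they are
  \<open>- k v\<close>, \<open>f\<^sub>2\<close>, \<open>f\<^sub>4 - e f\<^sub>3\<close>, \<open>f\<^sub>3\<close>, normalized to form a symplectic basis.\<close>

definition kepler_solution :: "real \<Rightarrow> (real \<Rightarrow> real) \<Rightarrow> real \<Rightarrow> real^4^4" where
  "kepler_solution e T t = (let c = cos t; s = sin t; r = 1 + e * c; k = 1 / (1 - e\<^sup>2) in vector
    [vector [k * (r + e\<^sup>2 * s\<^sup>2), - c - e * s\<^sup>2,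
       - 3 * e * s / r + 3 * T t * (r + e\<^sup>2 * s\<^sup>2) - e * (s - e * s * c), s - e * s * c],
     vector [k * e * r * s, - r * s, - 1 + 3 * T t * e * r * s - e * (e - r * c), e - r * c],
     vector [- k * e * r * s, r * s, 2 - 3 * T t * e * r * s - e * r * c, r * c],
     vector [- k * r\<^sup>2, 2 * c + e * c\<^sup>2, - 3 * T t * r\<^sup>2 + e * (2 * s + e * s * c), - (2 * s + e * s * c)]])"

lemma Bmat_Kepler:
  assumes "1 + e * cos t \<noteq> 0"
  shows "Bmat 0 e t = vector [vector [1, 0, 0, 1], vector [0, 1, -1, 0],
     vector [0, -1, 1 - 3 / (1 + e * cos t), 0], vector [1, 0, 0, 1]]"
proof -
  have "sqrt 9 = 3" by (rule real_sqrt_unique) auto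
  then show ?thesis using assms by (simp add: Bmat_def vec_eq_iff forall_4 field_simps)
qed

text \<open>With w = 1 / r treated as a variable of its own, each entry of the equation is a
  polynomial identity in the sines, cosines, \<open>r\<close>, \<open>w\<close>, \<open>k\<close>
  and \<open>T t\<close>, which follows from w r = 1, r = 1 + e c and s^2 + c^2 = 1.\<close>

lemma kepler_solution_derivative:
  assumes r0: "1 + e * cos t \<noteq> 0"
    and T: "(T has_field_derivative 1 / (1 + e * cos t)\<^sup>2) (at t within S)"
  shows "(kepler_solution e T has_vector_derivative
     J4 ** Bmat 0 e t ** kepler_solution e T t) (at t within S)"
proof -
  define c s r w where "c = cos t" and "s = sin t" and "r = 1 + e * c" and "w = 1 / r"
  have wr: "w * r = 1" and sc: "s\<^sup>2 + c\<^sup>2 = 1" using r0 by (auto simp: w_def r_def c_def s_def)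
  have T': "(T has_field_derivative w\<^sup>2) (at t within S)"
    using T by (simp add: w_def r_def c_def power_divide)
  have JB: "J4 ** Bmat 0 e t = vector [vector [0, 1, - (1 - 3 * w), 0], vector [-1, 0, 0, -1],
     vector [1, 0, 0, 1], vector [0, 1, -1, 0]]"
    unfolding Bmat_Kepler[OF r0]
    by (simp add: vec_eq_iff forall_4 matrix_matrix_mult_def sum_4 J4_def w_def r_def c_def)
  have w': "((\<lambda>t. 1 / (1 + e * cos t)) has_field_derivative y) (at t within S)" if "e * s * w\<^sup>2 = y" for y
    using r0 that by (auto intro!: derivative_eq_intros simp: s_def w_def r_def c_def power2_eq_square)
  have T'': "(T has_field_derivative y) (at t within S)" if "w\<^sup>2 = y" for y
    using T' that by simp
  define k where "k = 1 / (1 - e\<^sup>2)"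
  have entry: "kepler_solution e T u = vector
    [vector [k * (1 + e * cos u + e\<^sup>2 * (sin u)\<^sup>2), - cos u - e * (sin u)\<^sup>2,
       - (3 * e * sin u * (1 / (1 + e * cos u))) + 3 * T u * (1 + e * cos u + e\<^sup>2 * (sin u)\<^sup>2) - e * (sin u - e * sin u * cos u), sin u - e * sin u * cos u],
     vector [k * e * (1 + e * cos u) * sin u, - ((1 + e * cos u) * sin u), - 1 + 3 * T u * e * (1 + e * cos u) * sin u - e * (e - (1 + e * cos u) * cos u), e - (1 + e * cos u) * cos u],
     vector [- (k * e * (1 + e * cos u) * sin u), (1 + e * cos u) * sin u, 2 - 3 * T u * e * (1 + e * cos u) * sin u - e * (1 + e * cos u) * cos u, (1 + e * cos u) * cos u],
     vector [- (k * (1 + e * cos u)\<^sup>2), 2 * cos u + e * (cos u)\<^sup>2, - (3 * T u * (1 + e * cos u)\<^sup>2) + e * (2 * sin u + e * sin u * cos u), - (2 * sin u + e * sin u * cos u)]]" for u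
    by (simp add: kepler_solution_def Let_def k_def)
  have row: "(J4 ** Bmat 0 e t ** X) $ 1 $ j = X $ 2 $ j - (1 - 3 * w) * X $ 3 $ j"
    "(J4 ** Bmat 0 e t ** X) $ 2 $ j = - X $ 1 $ j - X $ 4 $ j"
    "(J4 ** Bmat 0 e t ** X) $ 3 $ j = X $ 1 $ j + X $ 4 $ j"
    "(J4 ** Bmat 0 e t ** X) $ 4 $ j = X $ 2 $ j - X $ 3 $ j" for X :: "real^4^4" and j
    unfolding JB by (simp_all add: matrix_matrix_mult_def sum_4 algebra_simps)
  have pw: "x ^ (2 - Suc 0) = x" for x :: real by simp
  have r: "r = 1 + e * c" by (simp add: r_def)
  have "((\<lambda>u. kepler_solution e T u $ i $ j) has_field_derivative
      (J4 ** Bmat 0 e t ** kepler_solution e T t) $ i $ j) (at t within S)" for i j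
    apply (insert exhaust_4[of i] exhaust_4[of j])
    apply (elim disjE; simp only: row entry vector_4; thin_tac "_ = _"; (thin_tac "_ = _")?; (rule w' T'' derivative_eq_intros refl)+; simp only: c_def[symmetric] s_def[symmetric] r_def[symmetric] w_def[symmetric] pw of_nat_numeral)
    by ((simp add: algebra_simps; fail) | (use wr r sc in algebra))+
  then show ?thesis
    by (intro has_vector_derivative_vecI) (simp add: has_real_derivative_iff_has_vector_derivative)
qed

section \<open>Symplectic perturbations of a shear\<close>

text \<open>The first and third leading principal minors of the symmetric matrix with rows (a, b,
  c), (b, d, e), (c, e, f); their signs come from evaluating the form at suitable vectors.\<close>

lemma neg_definite_3:
  fixes a b c d e f :: real
  assumes neg: "\<And>x y z. (x, y, z) \<noteq> (0, 0, 0) \<Longrightarrow>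
     a * x\<^sup>2 + d * y\<^sup>2 + f * z\<^sup>2 + 2 * b * x * y + 2 * c * x * z + 2 * e * y * z < 0"
  shows "a < 0" and "a * (d * f - e\<^sup>2) - b * (b * f - e * c) + c * (b * e - d * c) < 0"
proof -
  show a: "a < 0" using neg[of 1 0 0] by simp
  define m where "m = a * d - b\<^sup>2"
  \<comment> \<open>\<open>a * m\<close> is the value of the form at (- b, a, 0).\<close>
  have "a * m < 0"
    using neg[of "- b" a 0] a by (simp add: m_def power2_eq_square algebra_simps)
  then have m: "m > 0" using a by (simp add: mult_less_0_iff)
  let ?D = "a * (d * f - e\<^sup>2) - b * (b * f - e * c) + c * (b * e - d * c)"
  \<comment> \<open>\<open>(?x, ?y, m)\<close> is the last column of the adjugate, so the form maps it to \<open>(0, 0, ?D)\<close>.\<close>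
  let ?x = "b * e - c * d" and ?y = "b * c - a * e"
  have "a * ?x\<^sup>2 + d * ?y\<^sup>2 + f * m\<^sup>2 + 2 * b * ?x * ?y + 2 * c * ?x * m + 2 * e * ?y * m = m * ?D"
    unfolding m_def by algebra
  then have "m * ?D < 0" using neg[of ?x ?y m] m by auto
  then show "?D < 0" using m by (simp add: mult_less_0_iff)
qed

definition shear13 :: "real \<Rightarrow> real^4^4" where
  "shear13 \<tau> = vector [vector [1, 0, \<tau>, 0], vector [0, 1, 0, 0], vector [0, 0, 1, 0], vector [0, 0, 0, 1]]"

text \<open>Only the restriction of \<open>K\<close> to the fixed space of the shear enters: with \<open>E = shear13 \<tau> - 1\<close>, the scaled
  coefficients \<open>c / \<delta>\<close> and \<open>d / \<delta>\<^sup>3\<close> are polynomials in \<open>\<delta>\<close> and \<open>G = (Y - 1) / \<delta>\<close>, and at \<open>G = J K\<close>, \<open>\<delta> = 0\<close>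
  they are \<open>- \<tau> K\<^sub>1\<^sub>1\<close> and \<open>- \<tau>\<close> times the minor of \<open>K\<close> with rows and columns 1, 2, 4.\<close>

lemma elliptic_perturbation_of_shear:
  fixes K :: "real^4^4"
  assumes \<tau>: "0 < \<tau>" and sym: "transpose K = K"
    and neg: "\<And>x. x $ 3 = 0 \<Longrightarrow> x \<noteq> 0 \<Longrightarrow> x \<bullet> (K *v x) < 0"
  obtains \<epsilon> where "0 < \<epsilon>"
    "\<And>\<delta> Y. \<lbrakk>0 < \<delta>; \<delta> < \<epsilon>; norm (Y - mat 1 - \<delta> *\<^sub>R (J4 ** K)) < \<epsilon> * \<delta>;
       transpose Y ** J4 ** Y = J4\<rbrakk> \<Longrightarrow> shear13 \<tau> ** Y \<in> elliptic_region"
proof -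
  have K: "K $ i $ j = K $ j $ i" for i j
    using arg_cong[OF sym, of "\<lambda>X. X $ j $ i"] by (simp add: transpose_def)
  define D where "D = K$1$1 * (K$2$2 * K$4$4 - (K$2$4)\<^sup>2) - K$1$2 * (K$1$2 * K$4$4 - K$2$4 * K$1$4)
    + K$1$4 * (K$1$2 * K$2$4 - K$2$2 * K$1$4)"
  have "K$1$1 * x\<^sup>2 + K$2$2 * y\<^sup>2 + K$4$4 * z\<^sup>2 + 2 * K$1$2 * x * y + 2 * K$1$4 * x * z + 2 * K$2$4 * y * z < 0"
    if "(x, y, z) \<noteq> (0, 0, 0)" for x y z
  proof -
    let ?v = "vector [x, y, 0, z] :: real^4"
    have "?v \<noteq> 0" using that by (auto simp: vec_eq_iff forall_4)
    then have "?v \<bullet> (K *v ?v) < 0" by (intro neg) simp_all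
    then show ?thesis
      by (simp add: inner_vec_def matrix_vector_mult_def sum_4 K[of 2 1] K[of 4 1] K[of 4 2]
          power2_eq_square algebra_simps)
  qed
  note neg3 = neg_definite_3[OF this]
  have K11: "K$1$1 < 0" by (rule neg3(1))
  have D: "D < 0" unfolding D_def by (rule neg3(2))
  define E where "E = shear13 \<tau> - mat 1"
  \<comment> \<open>The symplectic product of column \<open>i\<close> of \<open>X\<close> with
    column \<open>j\<close> of \<open>Y\<close>.\<close>
  define \<omega> where "\<omega> X i Y j = (transpose X ** J4 ** Y) $ i $ j" for X Y :: "real^4^4" and i j
  define fc where "fc p = - (trace (fst p) + \<tau> * fst p $ 3 $ 1)" for p :: "(real^4^4) \<times> real"
  define fd where "fd p = (let G = fst p; H = snd p *\<^sub>R G + E in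
     - (\<omega> G 1 G 2 * \<omega> H 3 G 4 - \<omega> G 1 H 3 * \<omega> G 2 G 4 + \<omega> G 1 G 4 * \<omega> G 2 H 3))"
    for p :: "(real^4^4) \<times> real"
  have cont: "continuous_on UNIV fc" "continuous_on UNIV fd"
    unfolding fc_def fd_def Let_def \<omega>_def trace_def matrix_matrix_mult_def transpose_def
    by (auto intro!: continuous_intros)
  let ?p = "(J4 ** K, 0 :: real)"
  define U where "U = {p. 0 < fc p \<and> 0 < fd p \<and> snd p * fc p < 4 \<and> 4 * snd p * fd p < (fc p)\<^sup>2}"
  have "open U"
    unfolding U_def
    by (intro open_Collect_conj open_Collect_less continuous_intros cont)
  have fcK: "fc ?p = - (\<tau> * K$1$1)"
    by (simp add: fc_def trace_def matrix_matrix_mult_def sum_4 J4_def K[of 3 1] K[of 4 2])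
  have fdK: "fd ?p = - (\<tau> * D)"
    by (simp add: fd_def \<omega>_def E_def D_def shear13_def mat_def transpose_def matrix_matrix_mult_def sum_4 J4_def
        K[of 2 1] K[of 3 1] K[of 4 1] K[of 3 2] K[of 4 2] K[of 4 3] power2_eq_square algebra_simps)
  \<comment> \<open>At \<delta> = 0 the last two conditions of \<open>U\<close> read 0 < 4 and 0 <
    (fc ?p)^2, so only the signs of \<open>fc\<close> and \<open>fd\<close> matter.\<close>
  have "?p \<in> U"
    using K11 D \<tau> by (simp add: U_def fcK fdK mult_less_0_iff)
  then obtain \<epsilon> where \<epsilon>: "\<epsilon> > 0" "ball ?p \<epsilon> \<subseteq> U"
    using \<open>open U\<close> open_contains_ball by blast
  show thesis
  proof (rule that[of "\<epsilon> / 2"])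
    show "0 < \<epsilon> / 2" using \<epsilon>(1) by simp
    fix \<delta> :: real and Y :: "real^4^4"
    assume \<delta>: "0 < \<delta>" "\<delta> < \<epsilon> / 2" and Y: "norm (Y - mat 1 - \<delta> *\<^sub>R (J4 ** K)) < \<epsilon> / 2 * \<delta>"
      and YJ: "transpose Y ** J4 ** Y = J4"
    define G where "G = (1 / \<delta>) *\<^sub>R (Y - mat 1)"
    have YG: "Y = mat 1 + \<delta> *\<^sub>R G" using \<delta>(1) by (simp add: G_def)
    have "\<delta> * norm (G - J4 ** K) = norm (\<delta> *\<^sub>R (G - J4 ** K))" using \<delta>(1) by simp
    also have "\<dots> < \<epsilon> / 2 * \<delta>" using Y by (simp add: YG scaleR_right_diff_distrib)
    finally have "norm (G - J4 ** K) < \<epsilon> / 2" using \<delta>(1) by (simp add: mult.commute)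
    moreover have "dist ?p (G, \<delta>) \<le> norm (G - J4 ** K) + \<delta>"
      using \<delta>(1) sqrt_sum_squares_le_sum[of "dist (J4 ** K) G" "dist 0 \<delta>"]
      unfolding dist_Pair_Pair by (simp add: dist_norm norm_minus_commute)
    ultimately have "(G, \<delta>) \<in> U" using \<epsilon>(2) \<delta>(2) by auto
    define N where "N = shear13 \<tau> ** Y"
    define X where "X = N - mat 1"
    define H where "H = \<delta> *\<^sub>R G + E"
    have N: "transpose N ** J4 ** N = J4"
    proof -
      have "transpose (shear13 \<tau>) ** J4 ** shear13 \<tau> = J4"
        by (simp add: shear13_def vec_eq_iff forall_4 transpose_def matrix_matrix_mult_def sum_4 J4_def)
      moreover have "transpose N ** J4 ** N = transpose Y ** (transpose (shear13 \<tau>) ** J4 ** shear13 \<tau>) ** Y"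
        by (simp add: N_def matrix_transpose_mul matrix_mul_assoc)
      ultimately show ?thesis by (simp add: YJ)
    qed
    have tr: "4 - trace N = \<delta> * fc (G, \<delta>)"
      by (simp add: N_def YG fc_def trace_def shear13_def mat_def matrix_matrix_mult_def sum_4 algebra_simps)
    \<comment> \<open>Since E^2 = 0, the shear fixes \<open>E\<close>. Being symplectic, it then
      drops out of the form in \<open>XH\<close>.\<close>
    have "X = shear13 \<tau> ** H"
      by (simp add: X_def N_def H_def E_def YG shear13_def mat_def vec_eq_iff forall_4
          matrix_matrix_mult_def sum_4 algebra_simps)
    then have XH: "transpose X ** J4 ** X = transpose H ** J4 ** H"
      by (simp add: shear13_def vec_eq_iff forall_4 transpose_def matrix_matrix_mult_def sum_4 J4_def algebra_simps)
    \<comment> \<open>Only the third column of \<open>E\<close> is nonzero. Each term of the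
      Pfaffian uses every column once, hence carries exactly three factors \<delta>.\<close>
    have Hc: "H $ i $ 1 = \<delta> * G $ i $ 1" "H $ i $ 2 = \<delta> * G $ i $ 2" "H $ i $ 4 = \<delta> * G $ i $ 4" for i
      using exhaust_4[of i] by (auto simp: H_def E_def shear13_def mat_def)
    have W: "\<omega> H 1 H 2 = \<delta>\<^sup>2 * \<omega> G 1 G 2" "\<omega> H 1 H 4 = \<delta>\<^sup>2 * \<omega> G 1 G 4" "\<omega> H 2 H 4 = \<delta>\<^sup>2 * \<omega> G 2 G 4"
      "\<omega> H 3 H 4 = \<delta> * \<omega> H 3 G 4" "\<omega> H 1 H 3 = \<delta> * \<omega> G 1 H 3" "\<omega> H 2 H 3 = \<delta> * \<omega> G 2 H 3"
      by (simp_all add: \<omega>_def transpose_def matrix_matrix_mult_def sum_4 J4_def Hc power2_eq_square algebra_simps)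
    have "- pfaffian4 (transpose H ** J4 ** H) = \<delta> ^ 3 * fd (G, \<delta>)"
      unfolding pfaffian4_def \<omega>_def[symmetric] W
      by (simp add: fd_def Let_def H_def power2_eq_square power3_eq_cube algebra_simps)
    then have d: "((trace N)\<^sup>2 - trace (N ** N)) / 2 + 2 - 2 * trace N = \<delta> ^ 3 * fd (G, \<delta>)"
      using symplectic_quadratic(2)[OF N] XH by (simp add: X_def)
    have "\<delta>\<^sup>2 * (4 * \<delta> * fd (G, \<delta>)) < \<delta>\<^sup>2 * (fc (G, \<delta>))\<^sup>2"
      using \<open>(G, \<delta>) \<in> U\<close> \<delta>(1) by (intro mult_strict_left_mono) (auto simp: U_def)
    then show "shear13 \<tau> ** Y \<in> elliptic_region"
      using \<open>(G, \<delta>) \<in> U\<close> \<delta>(1)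
      unfolding elliptic_region_def mem_Collect_eq Let_def N_def[symmetric] tr d
      by (simp add: U_def power2_eq_square power3_eq_cube mult_ac)
  qed
qed

section \<open>The monodromy for small mass parameter\<close>

definition Dmat :: "real \<Rightarrow> real \<Rightarrow> real^4^4" where
  "Dmat e t = vector [0, 0, vector [0, 0, 1 / (2 * (1 + e * cos t)), 0],
     vector [0, 0, 0, - 1 / (2 * (1 + e * cos t))]]"

lemma one_plus_e_cos_pos:
  fixes e :: real
  assumes "0 \<le> e" "e < 1"
  shows "0 < 1 + e * cos t" "1 + e * cos t \<le> 2"
proof -
  have "\<bar>e * cos t\<bar> < 1"
    using mult_left_le[of "\<bar>cos t\<bar>" e] assms by (simp add: abs_mult)
  then show "0 < 1 + e * cos t" "1 + e * cos t \<le> 2" by linarith+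
qed

lemma Bmat_eq_Kepler_plus:
  "Bmat \<beta> e t = Bmat 0 e t + (3 - sqrt (9 - \<beta>)) *\<^sub>R Dmat e t"
proof -
  have "sqrt 9 = 3" by (rule real_sqrt_unique) auto
  moreover have "(y - x) / d = (y - 3) / d + (3 - x) / d" "(y + x) / d = (y + 3) / d - (3 - x) / d"
    for x y d :: real by (simp_all add: add_divide_distrib diff_divide_distrib)
  note this[of "2 * e * cos t - 1" "sqrt (9 - \<beta>)" "2 * (1 + e * cos t)"]
  ultimately show ?thesis
    by (simp add: Bmat_def Dmat_def vec_eq_iff forall_4)
qed

lemma transpose_Bmat: "transpose (Bmat \<beta> e t) = Bmat \<beta> e t"
  by (simp add: vec_eq_iff forall_4 transpose_def Bmat_def)

lemma bounded_linear_transpose: "bounded_linear (transpose :: real^'n^'m \<Rightarrow> real^'m^'n)"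
  by (auto intro!: linear_conv_bounded_linear[THEN iffD1] linearI simp: vec_eq_iff transpose_def)

lemmas has_vector_derivative_transpose =
  bounded_linear.has_vector_derivative[OF bounded_linear_transpose]

text \<open>The derivative is X^T (J J B + B J^T J) X, and J^2 = -1, J^T J = 1 make the two terms
  cancel.\<close>

lemma hamiltonian_flow_preserves_J4:
  fixes X :: "real \<Rightarrow> real^4^4"
  assumes X: "\<And>t. t \<in> {a..b} \<Longrightarrow> (X has_vector_derivative J4 ** B t ** X t) (at t within {a..b})"
    and B: "\<And>t. t \<in> {a..b} \<Longrightarrow> transpose (B t) = B t" and t: "t \<in> {a..b}"
  shows "transpose (X t) ** J4 ** X t = transpose (X a) ** J4 ** X a"
proof -
  have "((\<lambda>t. transpose (X t) ** J4 ** X t) has_vector_derivative 0) (at t within {a..b})"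
    if t: "t \<in> {a..b}" for t
  proof -
    let ?X' = "J4 ** B t ** X t"
    have "((\<lambda>t. transpose (X t) ** J4 ** X t) has_vector_derivative
        (transpose (X t) ** J4) ** ?X' + (transpose (X t) ** 0 + transpose ?X' ** J4) ** X t) (at t within {a..b})"
      by (intro has_vector_derivative_matrix_mult has_vector_derivative_transpose
          has_vector_derivative_const X t)
    moreover have "transpose (X t) ** J4 ** ?X' = transpose (X t) ** (J4 ** J4) ** B t ** X t"
      by (simp only: matrix_mul_assoc)
    moreover have "transpose ?X' ** J4 ** X t = transpose (X t) ** B t ** (transpose J4 ** J4) ** X t"
      by (simp add: matrix_transpose_mul B[OF t] matrix_mul_assoc)
    ultimately show ?thesis
      by (simp add: transpose_J4 J4_square matrix_neg_left matrix_neg_right matrix_add_rdistrib)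
  qed
  then obtain c where "\<And>t. t \<in> {a..b} \<Longrightarrow> transpose (X t) ** J4 ** X t = c"
    using has_vector_derivative_zero_constant[OF convex_real_interval(5)] by blast
  then show ?thesis using t by simp
qed

lemma kepler_solution_initial_symplectic:
  assumes "e\<^sup>2 \<noteq> 1" "1 + e \<noteq> 0" "T 0 = 0"
  shows "transpose (kepler_solution e T 0) ** J4 ** kepler_solution e T 0 = J4"
proof -
  \<comment> \<open>At time 0 all entries are polynomials in \<open>p\<close> and \<open>e\<close>,
    related by p e = p - 1.\<close>
  define p where "p = 1 / (1 - e)"
  have "1 - e \<noteq> 0" using assms(1) by auto
  then have pe: "p * e = p - 1" by (simp add: p_def field_simps)
  define k where "k = 1 / (1 - e\<^sup>2)"
  have "1 - e\<^sup>2 = (1 - e) * (1 + e)" by (simp add: power2_eq_square algebra_simps)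
  then have "k * (1 + e) = p" using assms(2) by (simp add: p_def k_def)
  then have "k * (1 + e) = p" "k * (1 + e)\<^sup>2 = p * (1 + e)" by (auto simp: power2_eq_square)
  then have Z: "kepler_solution e T 0 = vector
    [vector [p, - 1, 0, 0], vector [0, 0, - 1 - e * (e - (1 + e)), e - (1 + e)],
     vector [0, 0, 2 - e * (1 + e), 1 + e], vector [- (p * (1 + e)), 2 + e, 0, 0]]"
    unfolding kepler_solution_def Let_def k_def[symmetric] using assms(3) by simp
  show ?thesis
    unfolding Z
    apply (simp add: vec_eq_iff forall_4 transpose_def matrix_matrix_mult_def sum_4 J4_def)
    apply (intro conjI)
    apply ((simp add: algebra_simps; fail) | (use pe in algebra))+
    done
qed

text \<open>Only the third column contains \<open>T\<close>; over one period it gains 3 T(2 pi) (1 -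
  e^2) times the first column.\<close>

lemma kepler_solution_monodromy:
  assumes "e\<^sup>2 \<noteq> 1" "T 0 = 0"
  shows "kepler_solution e T (2 * pi)
     = kepler_solution e T 0 ** shear13 (3 * T (2 * pi) * (1 - e\<^sup>2))"
proof -
  define k \<tau> where "k = 1 / (1 - e\<^sup>2)" and "\<tau> = 3 * T (2 * pi) * (1 - e\<^sup>2)"
  have k\<tau>: "k * x * \<tau> = 3 * T (2 * pi) * x" for x
    using assms(1) by (simp add: k_def \<tau>_def)
  show ?thesis
    unfolding kepler_solution_def Let_def k_def[symmetric] \<tau>_def[symmetric]
    using k\<tau>[of 1] assms(2)
    by (simp add: shear13_def vec_eq_iff forall_4 matrix_matrix_mult_def sum_4)
qed

text \<open>Expanding the square isolates the only term divided by r, namely - (a + m)^2 / (2 r).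
  Estimating it with r \<le> 2 leaves a trigonometric polynomial that integrates explicitly.\<close>

lemma kepler_quadratic_form_le:
  fixes a b e g t :: real
  assumes e: "0 \<le> e" "e < 1"
  defines "c \<equiv> cos t" and "s \<equiv> sin t"
  defines "r \<equiv> 1 + e * c" and "m \<equiv> b * c - g * s" and "n \<equiv> b * s + g * c"
  shows "((r * n)\<^sup>2 - (a + (1 + r) * m)\<^sup>2) / (2 * r)
    \<le> r * (n\<^sup>2 - m\<^sup>2) / 2 - a * m - m\<^sup>2 - (a + m)\<^sup>2 / 4"
proof -
  have r: "0 < r" "r \<le> 2" using one_plus_e_cos_pos[OF e, of t] by (simp_all add: r_def c_def)
  have "((r * n)\<^sup>2 - (a + (1 + r) * m)\<^sup>2) / (2 * r) = r * (n\<^sup>2 - m\<^sup>2) / 2 - a * m - m\<^sup>2 - (a + m)\<^sup>2 / (2 * r)"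
    using r(1) by (simp add: field_simps power2_eq_square)
  moreover have "(a + m)\<^sup>2 / 4 \<le> (a + m)\<^sup>2 / (2 * r)"
    using r by (intro divide_left_mono) auto
  ultimately show ?thesis by linarith
qed

text \<open>\<open>G\<close> is an explicit antiderivative. Its terms containing \<open>e\<close>
  are periodic, so the integral does not depend on the eccentricity.\<close>

lemma kepler_quadratic_form_integral:
  fixes a b e g :: real
  shows "((\<lambda>t. (1 + e * cos t) * ((b * sin t + g * cos t)\<^sup>2 - (b * cos t - g * sin t)\<^sup>2) / 2
      - a * (b * cos t - g * sin t) - (b * cos t - g * sin t)\<^sup>2 - (a + (b * cos t - g * sin t))\<^sup>2 / 4)
    has_integral - pi * (5 * (b\<^sup>2 + g\<^sup>2) / 4 + a\<^sup>2 / 2)) {0..2 * pi}"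
    (is "(?f has_integral ?I) _")
proof -
  define G where "G t = 1/2 * ((b\<^sup>2 - g\<^sup>2) * (- (sin t * cos t)) + 2 * b * g * (sin t)\<^sup>2
      + e * ((b\<^sup>2 - g\<^sup>2) * (2/3 * (sin t)^3 - sin t) - 4/3 * b * g * (cos t)^3))
      - 3/2 * a * (b * sin t + g * cos t)
      - 5/8 * (b\<^sup>2 * (t + sin t * cos t) - 2 * b * g * (sin t)\<^sup>2 + g\<^sup>2 * (t - sin t * cos t))
      - 1/4 * a\<^sup>2 * t" for t
  have "(?f has_integral G (2 * pi) - G 0) {0..2 * pi}"
  proof (rule fundamental_theorem_of_calculus)
    fix t :: real
    define c s where "c = cos t" and "s = sin t"
    have pw: "x ^ (2 - Suc 0) = x" "x ^ (3 - Suc 0) = x\<^sup>2" for x :: real by simp_all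
    have sc: "s\<^sup>2 + c\<^sup>2 = 1" unfolding c_def s_def by (rule sin_cos_squared_add)
    have "(G has_field_derivative ?f t) (at t within {0..2 * pi})"
      unfolding G_def
      apply ((rule derivative_eq_intros refl)+)
      apply (simp only: c_def[symmetric] s_def[symmetric] pw of_nat_numeral)
      using sc apply algebra
      done
    then show "(G has_vector_derivative ?f t) (at t within {0..2 * pi})"
      by (simp add: has_real_derivative_iff_has_vector_derivative)
  qed simp
  moreover have "G (2 * pi) - G 0 = ?I" by (simp add: G_def field_simps)
  ultimately show ?thesis by simp
qed

lemma Dmat_form: "y \<bullet> (Dmat e t *v y) = ((y $ 3)\<^sup>2 - (y $ 4)\<^sup>2) / (2 * (1 + e * cos t))"
  by (simp add: inner_vec_def matrix_vector_mult_def sum_4 Dmat_def power2_eq_square diff_divide_distrib)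

lemma kepler_form_negative:
  fixes x :: "real^4"
  assumes e: "0 \<le> e" "e < 1" and x: "x $ 3 = 0" "x \<noteq> 0"
    and K: "((\<lambda>t. transpose (kepler_solution e T t) ** Dmat e t ** kepler_solution e T t) has_integral K) {0..2 * pi}"
  shows "x \<bullet> (K *v x) < 0"
proof -
  \<comment> \<open>Since v = (0, 1) + e \<open>f\<^sub>2\<close>, the solution with coefficients
    \<open>x\<close> has position a (0, 1) + b \<open>f\<^sub>2\<close> + g
    \<open>f\<^sub>3\<close>; the secular column is absent because \<open>x $ 3 = 0\<close>.\<close>
  define k a b g where "k = 1 / (1 - e\<^sup>2)" and "a = - k * x $ 1" and "b = x $ 2 + e * a" and "g = x $ 4"
  have "e\<^sup>2 < 1" using e by (simp add: abs_square_less_1)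
  then have k: "k > 0" by (simp add: k_def)
  let ?Q = "\<lambda>M :: real^4^4. x \<bullet> (M *v x)"
  let ?M = "\<lambda>t. transpose (kepler_solution e T t) ** Dmat e t ** kepler_solution e T t"
  have "bounded_linear ?Q"
    by (intro linear_conv_bounded_linear[THEN iffD1] linearI)
      (simp_all add: matrix_vector_mult_add_rdistrib inner_add_right flip: scaleR_matrix_vector_assoc)
  then have QK: "((\<lambda>t. ?Q (?M t)) has_integral ?Q K) {0..2 * pi}"
    using has_integral_linear[OF K] by (simp add: o_def)
  have "?Q (?M t) \<le> (1 + e * cos t) * ((b * sin t + g * cos t)\<^sup>2 - (b * cos t - g * sin t)\<^sup>2) / 2
      - a * (b * cos t - g * sin t) - (b * cos t - g * sin t)\<^sup>2 - (a + (b * cos t - g * sin t))\<^sup>2 / 4" for t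
  proof -
    let ?y = "kepler_solution e T t *v x"
    define c s r where "c = cos t" and "s = sin t" and "r = 1 + e * c"
    have y3: "?y $ 3 = r * (b * s + g * c)"
      by (simp add: matrix_vector_mult_def sum_4 x(1) kepler_solution_def Let_def
          flip: c_def s_def k_def r_def)
        (simp add: a_def b_def g_def algebra_simps)
    have y4: "?y $ 4 = a + (1 + r) * (b * c - g * s)"
      by (simp add: matrix_vector_mult_def sum_4 x(1) kepler_solution_def Let_def
          flip: c_def s_def k_def r_def)
        (simp add: a_def b_def g_def r_def power2_eq_square algebra_simps)
    have "?Q (?M t) = ?y \<bullet> (Dmat e t *v ?y)"
      using dot_lmul_matrix[of "Dmat e t *v ?y" "kepler_solution e T t" x]
      by (simp add: inner_commute flip: matrix_vector_mul_assoc)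
    also have "\<dots> = ((?y $ 3)\<^sup>2 - (?y $ 4)\<^sup>2) / (2 * r)"
      unfolding Dmat_form r_def c_def ..
    finally show ?thesis
      using kepler_quadratic_form_le[OF e, where t = t and a = a and b = b and g = g]
      by (simp add: y3 y4 r_def c_def s_def)
  qed
  then have "?Q K \<le> - pi * (5 * (b\<^sup>2 + g\<^sup>2) / 4 + a\<^sup>2 / 2)"
    by (intro has_integral_le[OF QK kepler_quadratic_form_integral])
  also have "\<dots> < 0"
  proof -
    have "a \<noteq> 0 \<or> b \<noteq> 0 \<or> g \<noteq> 0"
      using x k by (auto simp: a_def b_def g_def vec_eq_iff forall_4)
    then have "0 < a\<^sup>2 \<or> 0 < b\<^sup>2 + g\<^sup>2"
      unfolding sum_power2_gt_zero_iff zero_less_power2 by blast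
    then have "0 < 5 * (b\<^sup>2 + g\<^sup>2) / 4 + a\<^sup>2 / 2"
    proof
      assume "0 < a\<^sup>2"
      then show ?thesis by (intro add_nonneg_pos) auto
    next
      assume "0 < b\<^sup>2 + g\<^sup>2"
      then show ?thesis
        using add_pos_nonneg[of "5 * (b\<^sup>2 + g\<^sup>2) / 4" "a\<^sup>2 / 2"] by simp
    qed
    then show ?thesis by simp
  qed
  finally show ?thesis .
qed

text \<open>Variation of constants: writing \<gamma>(t) Z(0) = Z(t) Y(t) in the Kepler frame gives
  Y' = \<delta> J Q Y with Q = Z^T D Z. At 2 pi the frame contributes the shear and
  \<open>linear_ode_first_order\<close> expands \<open>Y\<close>, with \<open>C\<close> uniform in
  \<beta>.\<close>

lemma fundamental_solution_monodromy:
  assumes e: "0 \<le> e" "e < 1"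
  obtains Z0 K :: "real^4^4" and \<tau> C where
    "invertible Z0" "0 < \<tau>" "transpose K = K" "\<And>x. x $ 3 = 0 \<Longrightarrow> x \<noteq> 0 \<Longrightarrow> x \<bullet> (K *v x) < 0" "0 < C"
    "\<And>\<beta> \<gamma>. \<lbrakk>0 \<le> 3 - sqrt (9 - \<beta>); C * (3 - sqrt (9 - \<beta>)) \<le> 1; is_fundamental_solution \<beta> e \<gamma>\<rbrakk> \<Longrightarrow>
       \<gamma> (2 * pi) \<in> Sp4 \<and>
       (\<exists>Y. transpose Y ** J4 ** Y = J4 \<and> \<gamma> (2 * pi) ** Z0 = Z0 ** (shear13 \<tau> ** Y) \<and>
         norm (Y - mat 1 - (3 - sqrt (9 - \<beta>)) *\<^sub>R (J4 ** K)) \<le> C * (3 - sqrt (9 - \<beta>))\<^sup>2)"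
proof -
  note pos = one_plus_e_cos_pos[OF e]
  have ne: "1 + e * cos t \<noteq> 0" for t using pos(1)[of t] by simp
  have e2: "e\<^sup>2 < 1" using e by (simp add: abs_square_less_1)
  define T where "T t = integral {0..t} (\<lambda>u. 1 / (1 + e * cos u)\<^sup>2)" for t
  have contT: "continuous_on {0..2 * pi} (\<lambda>u. 1 / (1 + e * cos u)\<^sup>2)"
    using ne by (intro continuous_intros) auto
  have T0: "T 0 = 0" by (simp add: T_def)
  have T': "(T has_field_derivative 1 / (1 + e * cos t)\<^sup>2) (at t within {0..2 * pi})" if "t \<in> {0..2 * pi}" for t
    unfolding T_def using integral_has_real_derivative[OF contT that] .
  have Tpos: "0 < T (2 * pi)"
  proof -
    \<comment> \<open>The bound 1 / 4 comes from 1 + e cos u \<le> 2.\<close>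
    have "integral {0..2 * pi} (\<lambda>u. 1 / 4) \<le> T (2 * pi)"
      unfolding T_def
    proof (rule integral_le)
      show "1 / 4 \<le> 1 / (1 + e * cos u)\<^sup>2" for u
      proof -
        have "(1 + e * cos u)\<^sup>2 \<le> 2\<^sup>2" using pos[of u] by (intro power_mono) auto
        then show ?thesis using pos(1)[of u] by (intro divide_left_mono) auto
      qed
    qed (use contT in \<open>auto intro: integrable_continuous_real\<close>)
    then have "pi \<le> 2 * T (2 * pi)" by simp
    then show ?thesis using pi_gt_zero by linarith
  qed
  define Z where "Z = kepler_solution e T"
  have Z': "(Z has_vector_derivative J4 ** Bmat 0 e t ** Z t) (at t within {0..2 * pi})" if "t \<in> {0..2 * pi}" for t
    unfolding Z_def by (rule kepler_solution_derivative[OF ne T'[OF that]])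
  have Z0: "transpose (Z 0) ** J4 ** Z 0 = J4"
    unfolding Z_def using e2 e T0 by (intro kepler_solution_initial_symplectic) auto
  have ZJ: "transpose (Z t) ** J4 ** Z t = J4" if "t \<in> {0..2 * pi}" for t
    using hamiltonian_flow_preserves_J4[OF Z' transpose_Bmat that] Z0 by simp
  define \<tau> where "\<tau> = 3 * T (2 * pi) * (1 - e\<^sup>2)"
  have mono: "Z (2 * pi) = Z 0 ** shear13 \<tau>"
    unfolding Z_def \<tau>_def using e2 T0 by (intro kepler_solution_monodromy) auto
  define Q where "Q t = transpose (Z t) ** Dmat e t ** Z t" for t
  have contM: "continuous_on S (\<lambda>t. A t ** B t)" if "continuous_on S A" "continuous_on S B"
    for S and A B :: "real \<Rightarrow> real^4^4"
    by (rule bounded_bilinear.continuous_on[OF bounded_bilinear_matrix_mult that])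
  have contZ: "continuous_on {0..2 * pi} Z" "continuous_on {0..2 * pi} (\<lambda>t. transpose (Z t))"
    using continuous_on_vector_derivative[OF Z']
      continuous_on_vector_derivative[OF has_vector_derivative_transpose[OF Z']] by auto
  have "Dmat e t = (1 / (2 * (1 + e * cos t))) *\<^sub>R vector [0, 0, vector [0, 0, 1, 0], vector [0, 0, 0, - 1]]" for t
    by (simp add: Dmat_def vec_eq_iff forall_4)
  then have "continuous_on {0..2 * pi} (Dmat e)"
    using ne by (auto intro!: continuous_intros simp del: distrib_left_numeral)
  then have contQ: "continuous_on {0..2 * pi} Q"
    unfolding Q_def by (intro contM contZ)
  define K where "K = integral {0..2 * pi} Q"
  have QK: "(Q has_integral K) {0..2 * pi}"
    unfolding K_def using integrable_integral[OF integrable_continuous_real[OF contQ]] .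
  have symQ: "transpose (Q t) = Q t" for t
  proof -
    have "transpose (Dmat e t) = Dmat e t"
      by (simp add: Dmat_def transpose_def vec_eq_iff forall_4)
    then show ?thesis by (simp add: Q_def matrix_transpose_mul matrix_mul_assoc)
  qed
  have "(Q has_integral transpose K) {0..2 * pi}"
    using has_integral_linear[OF QK bounded_linear_transpose] by (simp add: o_def symQ)
  then have symK: "transpose K = K"
    using QK by (rule has_integral_unique)
  have JK: "integral {0..2 * pi} (\<lambda>t. J4 ** Q t) = J4 ** K"
    using has_integral_linear[OF QK bounded_bilinear.bounded_linear_right[OF bounded_bilinear_matrix_mult]]
    unfolding o_def by (rule integral_unique)
  obtain C where C: "0 < C"
    "\<And>\<delta> Y. \<lbrakk>0 \<le> \<delta>; C * \<delta> \<le> 1; Y 0 = mat 1;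
       \<forall>t\<in>{0..2 * pi}. (Y has_vector_derivative \<delta> *\<^sub>R ((J4 ** Q t) ** Y t)) (at t within {0..2 * pi})\<rbrakk>
     \<Longrightarrow> norm (Y (2 * pi) - mat 1 - \<delta> *\<^sub>R (J4 ** K)) \<le> C * \<delta>\<^sup>2"
  proof (rule linear_ode_first_order[OF _ contM[OF continuous_on_const contQ], of J4, unfolded JK], goal_cases)
    case (2 C)
    show thesis by (rule that[OF 2(2)]) (rule 2(3))
  qed simp
  show thesis
  proof (rule that)
    show "invertible (Z 0)" using symplectic_inv_left[OF Z0] invertible_left_inverse by blast
    show "0 < \<tau>" using Tpos e2 by (simp add: \<tau>_def)
    show "x \<bullet> (K *v x) < 0" if "x $ 3 = 0" "x \<noteq> 0" for x
      using kepler_form_negative[OF e that QK[unfolded Q_def Z_def]] .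
    fix \<beta> \<gamma>
    define \<delta> where "\<delta> = 3 - sqrt (9 - \<beta>)"
    assume \<delta>: "0 \<le> 3 - sqrt (9 - \<beta>)" "C * (3 - sqrt (9 - \<beta>)) \<le> 1" and \<gamma>: "is_fundamental_solution \<beta> e \<gamma>"
    have \<gamma>0: "\<gamma> 0 = mat 1"
      and \<gamma>': "\<And>t. t \<in> {0..2 * pi} \<Longrightarrow> (\<gamma> has_vector_derivative J4 ** Bmat \<beta> e t ** \<gamma> t) (at t within {0..2 * pi})"
      using \<gamma> by (auto simp: is_fundamental_solution_def)
    have \<gamma>J: "transpose (\<gamma> (2 * pi)) ** J4 ** \<gamma> (2 * pi) = J4"
      using hamiltonian_flow_preserves_J4[OF \<gamma>' transpose_Bmat, of "2 * pi"] by (simp add: \<gamma>0)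
    define Y where "Y t = symplectic_inv (Z t) ** (\<gamma> t ** Z 0)" for t
    have ZY: "Z t ** Y t = \<gamma> t ** Z 0" if "t \<in> {0..2 * pi}" for t
      using symplectic_inv_right[OF ZJ[OF that]] by (simp add: Y_def matrix_mul_assoc)
    have Y': "(Y has_vector_derivative \<delta> *\<^sub>R ((J4 ** Q t) ** Y t)) (at t within {0..2 * pi})"
      if t: "t \<in> {0..2 * pi}" for t
    proof -
      let ?B = "Bmat 0 e t" and ?B' = "Bmat \<beta> e t"
      have inv': "((\<lambda>t. symplectic_inv (Z t)) has_vector_derivative symplectic_inv (J4 ** ?B ** Z t))
          (at t within {0..2 * pi})"
        unfolding symplectic_inv_def
        by (intro has_vector_derivative_minus bounded_linear.has_vector_derivative[OF
            bounded_bilinear.bounded_linear_left[OF bounded_bilinear_matrix_mult]]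
            bounded_linear.has_vector_derivative[OF
            bounded_bilinear.bounded_linear_right[OF bounded_bilinear_matrix_mult]]
            has_vector_derivative_transpose Z' t)
      have "(Y has_vector_derivative symplectic_inv (Z t) ** (J4 ** ?B' ** \<gamma> t ** Z 0)
          + symplectic_inv (J4 ** ?B ** Z t) ** (\<gamma> t ** Z 0)) (at t within {0..2 * pi})"
        unfolding Y_def
        by (intro has_vector_derivative_matrix_mult inv' bounded_linear.has_vector_derivative[OF
            bounded_bilinear.bounded_linear_left[OF bounded_bilinear_matrix_mult]] \<gamma>' t)
      moreover have "symplectic_inv (J4 ** ?B ** Z t) = - (J4 ** transpose (Z t) ** ?B)"
      proof -
        have "symplectic_inv (J4 ** ?B ** Z t) = - (J4 ** transpose (Z t) ** ?B ** (transpose J4 ** J4))"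
          by (simp only: symplectic_inv_def matrix_transpose_mul transpose_Bmat matrix_mul_assoc)
        then show ?thesis by (simp add: transpose_J4 J4_square matrix_neg_left)
      qed
      moreover have "symplectic_inv (Z t) ** (J4 ** ?B' ** \<gamma> t ** Z 0)
          = J4 ** transpose (Z t) ** ?B' ** (\<gamma> t ** Z 0)"
      proof -
        have "symplectic_inv (Z t) ** (J4 ** ?B' ** \<gamma> t ** Z 0)
          = - (J4 ** transpose (Z t) ** (J4 ** J4) ** ?B' ** (\<gamma> t ** Z 0))"
          by (simp only: symplectic_inv_def matrix_neg_left matrix_mul_assoc)
        then show ?thesis by (simp add: J4_square matrix_neg_left matrix_neg_right)
      qed
      \<comment> \<open>The Kepler parts cancel, leaving the perturbation \<delta>
        \<open>Dmat e t\<close>; replacing \<open>\<gamma> t ** Z 0\<close> by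
        \<open>Z t ** Y t\<close> produces \<open>Q t\<close>.\<close>
      moreover have "J4 ** transpose (Z t) ** ?B' ** (\<gamma> t ** Z 0) + - (J4 ** transpose (Z t) ** ?B) ** (\<gamma> t ** Z 0)
          = \<delta> *\<^sub>R ((J4 ** Q t) ** Y t)"
      proof -
        have "?B' = ?B + \<delta> *\<^sub>R Dmat e t" unfolding \<delta>_def by (rule Bmat_eq_Kepler_plus)
        then have "J4 ** transpose (Z t) ** ?B' = J4 ** transpose (Z t) ** ?B + \<delta> *\<^sub>R (J4 ** transpose (Z t) ** Dmat e t)"
          by (simp add: matrix_add_ldistrib bounded_bilinear.scaleR_right[OF bounded_bilinear_matrix_mult])
        then have "J4 ** transpose (Z t) ** ?B' ** (\<gamma> t ** Z 0) + - (J4 ** transpose (Z t) ** ?B) ** (\<gamma> t ** Z 0)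
          = \<delta> *\<^sub>R (J4 ** transpose (Z t) ** Dmat e t ** (\<gamma> t ** Z 0))"
          by (simp add: matrix_add_rdistrib matrix_neg_left bounded_bilinear.scaleR_left[OF bounded_bilinear_matrix_mult])
        then show ?thesis
          by (simp add: Q_def matrix_mul_assoc flip: ZY[OF t])
      qed
      ultimately show ?thesis by simp
    qed
    have Y0: "Y 0 = mat 1"
      using symplectic_inv_left[OF Z0] by (simp add: Y_def \<gamma>0)
    have YJ: "transpose (Y (2 * pi)) ** J4 ** Y (2 * pi) = J4"
    proof -
      let ?Z = "Z (2 * pi)" and ?Y = "Y (2 * pi)"
      have "transpose ?Y ** J4 ** ?Y = transpose ?Y ** (transpose ?Z ** J4 ** ?Z) ** ?Y"
        by (simp add: ZJ)
      also have "\<dots> = transpose (?Z ** ?Y) ** J4 ** (?Z ** ?Y)"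
        by (simp add: matrix_transpose_mul matrix_mul_assoc)
      also have "\<dots> = transpose (Z 0) ** (transpose (\<gamma> (2 * pi)) ** J4 ** \<gamma> (2 * pi)) ** Z 0"
        by (simp add: ZY matrix_transpose_mul matrix_mul_assoc)
      finally show ?thesis by (simp add: \<gamma>J Z0)
    qed
    have "\<gamma> (2 * pi) ** Z 0 = Z 0 ** (shear13 \<tau> ** Y (2 * pi))"
      using ZY[of "2 * pi"] by (simp add: mono matrix_mul_assoc)
    moreover have "norm (Y (2 * pi) - mat 1 - \<delta> *\<^sub>R (J4 ** K)) \<le> C * \<delta>\<^sup>2"
      using C(2)[of \<delta> Y] Y0 Y' \<delta> by (simp add: \<delta>_def)
    ultimately show "\<gamma> (2 * pi) \<in> Sp4 \<and>
       (\<exists>Y. transpose Y ** J4 ** Y = J4 \<and> \<gamma> (2 * pi) ** Z 0 = Z 0 ** (shear13 \<tau> ** Y) \<and>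
         norm (Y - mat 1 - (3 - sqrt (9 - \<beta>)) *\<^sub>R (J4 ** K)) \<le> C * (3 - sqrt (9 - \<beta>))\<^sup>2)"
      using YJ \<gamma>J unfolding \<delta>_def[symmetric] Sp4_iff by blast
  qed (use symK C(1) in auto)
qed

theorem corollary1p3:
  fixes e :: real
  assumes "0 \<le> e" and "e < 1"
  shows "\<exists>\<beta>0. 0 < \<beta>0 \<and> \<beta>0 \<le> 9 \<and>
           (\<forall>\<beta> \<gamma>. 0 < \<beta> \<and> \<beta> < \<beta>0 \<and> is_fundamental_solution \<beta> e \<gamma>
              \<longrightarrow> strongly_linearly_stable (\<gamma> (2 * pi)))"
proof -
  obtain Z0 K :: "real^4^4" and \<tau> C where Z0: "invertible Z0" and \<tau>: "0 < \<tau>" and symK: "transpose K = K"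
    and negK: "\<And>x. x $ 3 = 0 \<Longrightarrow> x \<noteq> 0 \<Longrightarrow> x \<bullet> (K *v x) < 0" and C: "0 < C"
    and mono: "\<And>\<beta> \<gamma>. \<lbrakk>0 \<le> 3 - sqrt (9 - \<beta>); C * (3 - sqrt (9 - \<beta>)) \<le> 1; is_fundamental_solution \<beta> e \<gamma>\<rbrakk> \<Longrightarrow>
       \<gamma> (2 * pi) \<in> Sp4 \<and>
       (\<exists>Y. transpose Y ** J4 ** Y = J4 \<and> \<gamma> (2 * pi) ** Z0 = Z0 ** (shear13 \<tau> ** Y) \<and>
         norm (Y - mat 1 - (3 - sqrt (9 - \<beta>)) *\<^sub>R (J4 ** K)) \<le> C * (3 - sqrt (9 - \<beta>))\<^sup>2)"
    by (rule fundamental_solution_monodromy[OF assms]) blast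
  obtain \<epsilon> where \<epsilon>: "0 < \<epsilon>"
    "\<And>\<delta> Y. \<lbrakk>0 < \<delta>; \<delta> < \<epsilon>; norm (Y - mat 1 - \<delta> *\<^sub>R (J4 ** K)) < \<epsilon> * \<delta>;
       transpose Y ** J4 ** Y = J4\<rbrakk> \<Longrightarrow> shear13 \<tau> ** Y \<in> elliptic_region"
    by (rule elliptic_perturbation_of_shear[OF \<tau> symK negK]) blast+
  \<comment> \<open>As \<delta> \<le> \<beta>, these bounds give \<delta> < \<epsilon>, C \<delta> <
    1 for the expansion, and C \<delta>^2 < \<epsilon> \<delta> for its error.\<close>
  define \<beta>0 where "\<beta>0 = min 9 (min \<epsilon> (min (1 / C) (\<epsilon> / C)))"
  show ?thesis
  proof (intro exI[of _ \<beta>0] conjI allI impI)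
    show "0 < \<beta>0" "\<beta>0 \<le> 9" using C \<epsilon>(1) by (auto simp: \<beta>0_def)
    fix \<beta> \<gamma>
    assume "0 < \<beta> \<and> \<beta> < \<beta>0 \<and> is_fundamental_solution \<beta> e \<gamma>"
    then have \<beta>: "0 < \<beta>" "\<beta> < \<beta>0" and \<gamma>: "is_fundamental_solution \<beta> e \<gamma>" by auto
    define \<delta> where "\<delta> = 3 - sqrt (9 - \<beta>)"
    have "sqrt (9 - \<beta>) < 3" using \<beta> by (intro real_less_lsqrt) auto
    then have \<delta>0: "0 < \<delta>" by (simp add: \<delta>_def)
    \<comment> \<open>This is \<delta> \<le> \<beta>. After squaring it reads \<beta>^2 \<le> 5
      \<beta>; beyond \<beta> = 3 the left side is negative.\<close>
    have "3 - \<beta> \<le> sqrt (9 - \<beta>)"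
    proof (cases "\<beta> \<le> 3")
      case True
      then have "\<beta> * \<beta> \<le> \<beta> * 3" using \<beta>(1) by (intro mult_left_mono) auto
      then show ?thesis using \<beta>(1) by (intro real_le_rsqrt) (simp add: power2_eq_square algebra_simps)
    next
      case False
      have "0 \<le> sqrt (9 - \<beta>)" using \<beta> by (simp add: \<beta>0_def)
      then show ?thesis using False by linarith
    qed
    then have \<delta>: "\<delta> < \<epsilon>" "\<delta> < 1 / C" "\<delta> < \<epsilon> / C" using \<beta> by (auto simp: \<delta>_def \<beta>0_def)
    then have C\<delta>: "C * \<delta> < 1" "C * \<delta> < \<epsilon>" using C by (auto simp: field_simps)
    obtain Y where Sp: "\<gamma> (2 * pi) \<in> Sp4" and YJ: "transpose Y ** J4 ** Y = J4"
      and conj: "\<gamma> (2 * pi) ** Z0 = Z0 ** (shear13 \<tau> ** Y)"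
      and Y: "norm (Y - mat 1 - \<delta> *\<^sub>R (J4 ** K)) \<le> C * \<delta>\<^sup>2"
      using mono[OF _ _ \<gamma>] \<delta>0 C\<delta>(1) unfolding \<delta>_def by auto
    have "C * \<delta>\<^sup>2 < \<epsilon> * \<delta>"
      using mult_strict_right_mono[OF C\<delta>(2) \<delta>0] by (simp add: power2_eq_square mult.assoc)
    then have el: "shear13 \<tau> ** Y \<in> elliptic_region"
      using \<epsilon>(2)[OF \<delta>0 \<delta>(1) _ YJ] Y by simp
    obtain W where "Z0 ** W = mat 1" using Z0 by (auto simp: invertible_def)
    then have "\<gamma> (2 * pi) \<in> elliptic_region"
      by (rule elliptic_region_similar[OF el _ conj])
    then show "strongly_linearly_stable (\<gamma> (2 * pi))"
      by (rule strongly_linearly_stable_if_elliptic[OF Sp])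
  qed
qed

end
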